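(* Let $V$ be a Hermitian vector space of dimension $M<\infty$ and let $U(x)$, $x\in\mathbb{R}$, be a monotone unitary family on $V$. Then $\mathcal{Z}=\{x\in\mathbb{R}:\ W(x)\neq\{0\}\}$ is a discrete subset of $\mathbb{R}$, and more precisely, for all real $A<B$, $$\left|\ \sum_{x:\,A<x<B}\dim W(x)\;-\;\frac{1}{2\pi}\int_A^B \operatorname{tr} D(x)\,dx\ \right|< M=\dim V .$$
   Context: A Hermitian vector space is a finite-dimensional complex vector space with a Hermitian inner product. A unitary family on $V$ (over $\mathbb{R}$) is a family of unitary operators $U(x)$ on $V$ depending real analytically on $x\in\mathbb{R}$. Put $D(x):=\frac{1}{i}U'(x)U(x)^{-1}$, where $'$ is the derivative in $x$; this is a symmetric (self-adjoint) operator. The family is called monotone if $D(x)$ is a positive operator (i.e. positive definite) for every $x$. Notation: $W(x):=\ker(I-U(x))$, where $I$ is the identity operator on $V$; thus $x\in\mathcal{Z}$ if and only if $U(x)$ has eigenvalue one.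
   Formalization: The strict bound < M fails when U(A) = U(B) = I (e.g. U(x) = e^{ix}, A = 0, B = 2π) and when dim V = 0; proved here for dim V ≥ 1: the bound ≤ M for all A < B, and strict < M unless U(A) = U(B) = I. *)

theory Defs
  imports "HOL-Analysis.Analysis"
begin

text \<open>
  A nonzero Hermitian vector space, as a type. The superclass provides the underlying real Euclidean
  space, so the norm and the topology are those of the Hermitian inner product; positive
  definiteness of \<open>cinner\<close> is inherited through \<open>inner_eq_Re_cinner\<close>, and finite-dimensionality
  from the real basis. The inner product is linear in the first argument.
\<close>

class hermitian_space = euclidean_space +
  fixes scaleC :: "complex \<Rightarrow> 'a \<Rightarrow> 'a"  (infixr \<open>*\<^sub>C\<close> 75)
    and cinner :: "'a \<Rightarrow> 'a \<Rightarrow> complex"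
  assumes scaleC_add_right: "c *\<^sub>C (x + y) = c *\<^sub>C x + c *\<^sub>C y"
    and scaleC_add_left: "(c + d) *\<^sub>C x = c *\<^sub>C x + d *\<^sub>C x"
    and scaleC_scaleC: "c *\<^sub>C d *\<^sub>C x = (c * d) *\<^sub>C x"
    and scaleC_of_real: "complex_of_real r *\<^sub>C x = r *\<^sub>R x"
    and cinner_commute: "cinner x y = cnj (cinner y x)"
    and cinner_add_left: "cinner (x + y) z = cinner x z + cinner y z"
    and cinner_scaleC_left: "cinner (c *\<^sub>C x) y = c * cinner x y"
    and inner_eq_Re_cinner: "x \<bullet> y = Re (cinner x y)"

global_interpretation complex_vector: vector_space "scaleC :: complex \<Rightarrow> 'a \<Rightarrow> 'a :: hermitian_space"
  defines cdependent = complex_vector.dependent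
    and crepresentation = complex_vector.representation
    and csubspace = complex_vector.subspace
    and cspan = complex_vector.span
    and cextend_basis = complex_vector.extend_basis
    and cdim = complex_vector.dim
proof unfold_locales
  show "1 *\<^sub>C x = x" for x :: 'a
    using scaleC_of_real[of 1 x] by simp
qed (simp_all add: scaleC_add_right scaleC_add_left scaleC_scaleC)

text \<open>The class is inhabited in every positive dimension.\<close>

instantiation complex :: hermitian_space
begin
definition scaleC_complex :: "complex \<Rightarrow> complex \<Rightarrow> complex" where "scaleC_complex c x = c * x"
definition cinner_complex :: "complex \<Rightarrow> complex \<Rightarrow> complex" where "cinner_complex x y = x * cnj y"
instance
  by standard (simp_all add: scaleC_complex_def cinner_complex_def inner_complex_def
      scaleR_conv_of_real algebra_simps)
end

instantiation vec :: (hermitian_space, finite) hermitian_space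
begin
definition scaleC_vec :: "complex \<Rightarrow> 'a ^ 'b \<Rightarrow> 'a ^ 'b" where "scaleC_vec c x = (\<chi> i. c *\<^sub>C x $ i)"
definition cinner_vec :: "'a ^ 'b \<Rightarrow> 'a ^ 'b \<Rightarrow> complex" where "cinner_vec x y = (\<Sum>i\<in>UNIV. cinner (x $ i) (y $ i))"
instance
proof
  fix x y :: "'a ^ 'b"
  show "cinner x y = cnj (cinner y x)"
    unfolding cinner_vec_def cnj_sum by (rule sum.cong[OF refl], rule cinner_commute)
qed (simp_all add: scaleC_vec_def cinner_vec_def inner_vec_def vec_eq_iff scaleC_add_right
      scaleC_add_left scaleC_scaleC scaleC_of_real cinner_add_left cinner_scaleC_left
      inner_eq_Re_cinner sum.distrib sum_distrib_left)
end

abbreviation clinear :: "('a::hermitian_space \<Rightarrow> 'a) \<Rightarrow> bool"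
  where "clinear \<equiv> Vector_Spaces.linear scaleC scaleC"

definition unitary_operator :: "('a::hermitian_space \<Rightarrow> 'a) \<Rightarrow> bool"
  where "unitary_operator T \<longleftrightarrow> clinear T \<and> surj T \<and> (\<forall>v w. cinner (T v) (T w) = cinner v w)"

definition positive_operator :: "('a::hermitian_space \<Rightarrow> 'a) \<Rightarrow> bool"
  where "positive_operator T \<longleftrightarrow> clinear T \<and> (\<forall>v w. cinner (T v) w = cinner v (T w)) \<and>
    (\<forall>v. v \<noteq> 0 \<longrightarrow> Re (cinner (T v) v) > 0)"

text \<open>The sum of the diagonal entries in some basis of the space (the value does not depend on it
  for linear operators).\<close>

definition op_trace :: "('a::hermitian_space \<Rightarrow> 'a) \<Rightarrow> complex"
  where "op_trace T = (\<Sum>b\<in>cextend_basis {}. crepresentation (cextend_basis {}) (T b) b)"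

definition real_analytic :: "(real \<Rightarrow> 'b::real_normed_vector) \<Rightarrow> bool"
  where "real_analytic f \<longleftrightarrow>
    (\<forall>x0. \<exists>r>0. \<exists>a. \<forall>x. \<bar>x - x0\<bar> < r \<longrightarrow> (\<lambda>n. (x - x0) ^ n *\<^sub>R a n) sums f x)"

text \<open>Operators are taken in the normed space of bounded real-linear operators, so that analyticity
  and the derivative in \<open>x\<close> are those for the operator norm; complex linearity is part of
  \<open>unitary_operator\<close>.\<close>

definition unitary_family :: "(real \<Rightarrow> 'a::hermitian_space \<Rightarrow>\<^sub>L 'a) \<Rightarrow> bool"
  where "unitary_family U \<longleftrightarrow> real_analytic U \<and> (\<forall>x. unitary_operator (blinfun_apply (U x)))"

definition fam_D :: "(real \<Rightarrow> 'a::hermitian_space \<Rightarrow>\<^sub>L 'a) \<Rightarrow> real \<Rightarrow> 'a \<Rightarrow> 'a"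
  where "fam_D U x = (\<lambda>v. (1 / \<i>) *\<^sub>C
    blinfun_apply (vector_derivative U (at x)) (inv (blinfun_apply (U x)) v))"

definition monotone_unitary_family :: "(real \<Rightarrow> 'a::hermitian_space \<Rightarrow>\<^sub>L 'a) \<Rightarrow> bool"
  where "monotone_unitary_family U \<longleftrightarrow> unitary_family U \<and> (\<forall>x. positive_operator (fam_D U x))"

definition fam_W :: "(real \<Rightarrow> 'a::hermitian_space \<Rightarrow>\<^sub>L 'a) \<Rightarrow> real \<Rightarrow> 'a set"
  where "fam_W U x = {v. blinfun_apply (id_blinfun - U x) v = 0}"

definition fam_Z :: "(real \<Rightarrow> 'a::hermitian_space \<Rightarrow>\<^sub>L 'a) \<Rightarrow> real set"
  where "fam_Z U = {x. fam_W U x \<noteq> {0}}"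

text \<open>The number of points of \<open>fam_Z U\<close> strictly between \<open>A\<close> and \<open>B\<close>, counted with multiplicity
  \<open>cdim (fam_W U x)\<close>, can differ from the normalized integral of the trace of \<open>fam_D U\<close> by exactly
  the dimension: for \<open>U x v = cis x * v\<close> on \<open>complex\<close>, \<open>A = 0\<close> and \<open>B = 2 * pi\<close>, the number is
  \<open>0\<close> and the integral \<open>1\<close>. Equality is possible only when both \<open>U A\<close> and \<open>U B\<close> are the
  identity, so strictness is claimed outside that case.\<close>

end

theory Submission
  imports Defs
begin

text \<open>
  Let \<open>lo x\<close> and \<open>hi x\<close> be the sums of the arguments of the eigenvalues of \<open>U x\<close>, taken in
  \<open>[0, 2\<pi>)\<close> and in \<open>(0, 2\<pi>]\<close> respectively, so that \<open>hi x = lo x + 2\<pi> dim W x\<close>. By monotonicity the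
  eigenvalues near 1 move counterclockwise; hence to the right of a point \<open>x0\<close> the arguments in
  \<open>[0, 2\<pi>)\<close> stay away from \<open>2\<pi>\<close>, and to the left of it the arguments in \<open>(0, 2\<pi>]\<close> stay away
  from 0. On such one-sided neighbourhoods the angle sums are differentiable with derivative
  \<open>tr D\<close>. No differentiable choice of eigenvalues is needed for this: for orthonormal eigenbases \<open>e\<close>
  of \<open>U x\<close> and \<open>f\<close> of \<open>U y\<close> with angles \<open>a\<close>, \<open>b\<close>, averaging \<open>|t - sin t| \<le> C (1 - cos t)\<close> at
  \<open>t = b f - a e\<close> with the weights \<open>|\<langle>e, f\<rangle>|\<^sup>2\<close> bounds the difference of the angle sums minus
  \<open>Im tr (U y (U x)\<^sup>* )\<close> by \<open>C\<close> times \<open>M - Re tr (U y (U x)\<^sup>* )\<close>, which vanishes to second order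
  at \<open>y = x\<close>. Integrating and adding the jumps, the integral of \<open>tr D\<close> over \<open>[A, B]\<close> equals
  \<open>hi B - lo A + 2\<pi> N\<close>, where \<open>N\<close> is the number of crossings, and
  \<open>0 \<le> lo A < 2\<pi> M\<close>, \<open>0 < hi B \<le> 2\<pi> M\<close>.
\<close>

subsection \<open>Hermitian inner product\<close>

lemma cinner_add_right: "cinner x (y + z) = cinner x y + cinner x z"
  using cinner_commute[of x "y + z"] cinner_commute[of x y] cinner_commute[of x z]
  by (simp add: cinner_add_left)

lemma cinner_scaleC_right: "cinner x (c *\<^sub>C y) = cnj c * cinner x y"
  using cinner_commute[of x "c *\<^sub>C y"] cinner_commute[of x y]
  by (simp add: cinner_scaleC_left)

lemma cinner_scaleR_left: "cinner (r *\<^sub>R x) y = r *\<^sub>R cinner x y"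
  by (metis cinner_scaleC_left scaleC_of_real scaleR_conv_of_real)

lemma cinner_scaleR_right: "cinner x (r *\<^sub>R y) = r *\<^sub>R cinner x y"
  by (metis cinner_scaleC_right scaleC_of_real scaleR_conv_of_real complex_cnj_complex_of_real)

lemma bounded_bilinear_cinner:
  "bounded_bilinear (cinner :: 'a::hermitian_space \<Rightarrow> 'a \<Rightarrow> complex)"
proof -
  have "bilinear (cinner :: 'a \<Rightarrow> 'a \<Rightarrow> complex)"
    unfolding bilinear_def
    by (auto intro!: linearI
        simp: cinner_add_left cinner_add_right cinner_scaleR_left cinner_scaleR_right)
  then show ?thesis
    by (simp add: bilinear_conv_bounded_bilinear)
qed

interpretation cinner: bounded_bilinear "cinner :: 'a::hermitian_space \<Rightarrow> 'a \<Rightarrow> complex"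
  by (rule bounded_bilinear_cinner)

lemma bounded_bilinear_scaleC:
  "bounded_bilinear (scaleC :: complex \<Rightarrow> 'a \<Rightarrow> 'a::hermitian_space)"
proof -
  have *: "(r *\<^sub>R c) *\<^sub>C x = r *\<^sub>R (c *\<^sub>C x)" for r c and x :: 'a
    by (simp only: scaleR_conv_of_real scaleC_scaleC[symmetric] scaleC_of_real[symmetric])
  have **: "c *\<^sub>C (r *\<^sub>R x) = r *\<^sub>R (c *\<^sub>C x)" for r c and x :: 'a
    by (simp only: scaleC_of_real[symmetric] scaleC_scaleC mult.commute)
  have "bilinear (scaleC :: complex \<Rightarrow> 'a \<Rightarrow> 'a)"
    unfolding bilinear_def by (auto intro!: linearI simp: scaleC_add_left scaleC_add_right * **)
  then show ?thesis
    by (simp add: bilinear_conv_bounded_bilinear)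
qed

interpretation scaleC: bounded_bilinear "scaleC :: complex \<Rightarrow> 'a \<Rightarrow> 'a::hermitian_space"
  by (rule bounded_bilinear_scaleC)

lemma cinner_self: "cinner x x = complex_of_real ((norm x)\<^sup>2)"
proof -
  have "Im (cinner x x) = 0"
    by (metis Reals_cnj_iff cinner_commute complex_is_Real_iff)
  moreover have "Re (cinner x x) = (norm x)\<^sup>2"
    by (simp add: inner_eq_Re_cinner[symmetric] power2_norm_eq_inner)
  ultimately show ?thesis
    by (simp add: complex_eq_iff)
qed

lemma cinner_eq_0_commute: "cinner x y = 0 \<longleftrightarrow> cinner y x = 0"
  by (metis cinner_commute complex_cnj_zero)

lemma scaleC_1 [simp]: "1 *\<^sub>C x = x"
  by (rule complex_vector.scale_one)

lemma norm_scaleC: "norm (c *\<^sub>C x) = cmod c * norm x"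
proof -
  have "complex_of_real ((norm (c *\<^sub>C x))\<^sup>2) = c * cnj c * complex_of_real ((norm x)\<^sup>2)"
    by (simp only: cinner_self[symmetric] cinner_scaleC_left cinner_scaleC_right mult.assoc mult.left_commute)
  also have "\<dots> = complex_of_real ((cmod c * norm x)\<^sup>2)"
    by (simp add: complex_norm_square[symmetric] power_mult_distrib)
  finally have "(norm (c *\<^sub>C x))\<^sup>2 = (cmod c * norm x)\<^sup>2"
    using of_real_eq_iff by blast
  then show ?thesis
    by (simp add: power2_eq_iff_nonneg)
qed

subsection \<open>Unitary operators\<close>

lemma clinear_add: "clinear T \<Longrightarrow> T (x + y) = T x + T y"
  and clinear_scaleC: "clinear T \<Longrightarrow> T (c *\<^sub>C x) = c *\<^sub>C T x"
  by (simp_all add: Vector_Spaces.linear_iff)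

lemma clinear_scaleR: "clinear T \<Longrightarrow> T (r *\<^sub>R x) = r *\<^sub>R T x"
  by (metis clinear_scaleC scaleC_of_real)

lemma clinear_imp_bounded_linear: "clinear T \<Longrightarrow> bounded_linear T"
  unfolding linear_conv_bounded_linear[symmetric]
  by (rule linearI) (simp_all add: clinear_add clinear_scaleR)

lemma clinear_sum: "clinear T \<Longrightarrow> T (sum f A) = (\<Sum>a\<in>A. T (f a))"
  by (rule linear_sum[OF bounded_linear.linear[OF clinear_imp_bounded_linear]])

lemma unitary_clinear: "unitary_operator T \<Longrightarrow> clinear T"
  and unitary_cinner: "unitary_operator T \<Longrightarrow> cinner (T v) (T w) = cinner v w"
  by (auto simp: unitary_operator_def)

lemma unitary_norm: "unitary_operator T \<Longrightarrow> norm (T v) = norm v"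
  by (metis cinner_self norm_ge_zero of_real_eq_iff power2_eq_iff_nonneg unitary_cinner)

lemma unitary_inj:
  assumes "unitary_operator T" shows "inj T"
proof -
  interpret bounded_linear T
    by (rule clinear_imp_bounded_linear[OF unitary_clinear[OF assms]])
  show ?thesis
    by (rule injI) (metis assms diff norm_eq_zero right_minus_eq unitary_norm)
qed

lemma unitary_inv_right: "unitary_operator T \<Longrightarrow> T (inv T v) = v"
  by (simp add: unitary_operator_def surj_f_inv_f)

lemma unitary_inv_left: "unitary_operator T \<Longrightarrow> inv T (T v) = v"
  by (simp add: unitary_inj)

lemma cinner_unitary_inv: "unitary_operator T \<Longrightarrow> cinner (inv T v) w = cinner v (T w)"
  by (metis unitary_cinner unitary_inv_right)

lemma unitary_eigenvalue_norm:
  assumes "unitary_operator T" "T v = l *\<^sub>C v" "v \<noteq> 0" shows "cmod l = 1"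
  using unitary_norm[OF assms(1), of v] assms(2,3) by (simp add: norm_scaleC)

lemma cmod_1_mult_cnj: "cmod l = 1 \<Longrightarrow> l * cnj l = 1" "cmod l = 1 \<Longrightarrow> cnj l * l = 1"
  by (simp_all add: complex_norm_square[symmetric] mult.commute)

lemma unitary_inv_eigen:
  assumes "unitary_operator T" "T v = l *\<^sub>C v" "v \<noteq> 0"
  shows "inv T v = cnj l *\<^sub>C v"
proof -
  have "T (cnj l *\<^sub>C v) = v"
    using cmod_1_mult_cnj[OF unitary_eigenvalue_norm[OF assms]] assms
    by (simp add: clinear_scaleC[OF unitary_clinear] scaleC_scaleC)
  then show ?thesis
    using unitary_inv_left[OF assms(1)] by metis
qed

subsection \<open>Orthonormal eigenbases\<close>

definition orthonormal :: "'a::hermitian_space set \<Rightarrow> bool"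
  where "orthonormal E \<longleftrightarrow> (\<forall>e\<in>E. \<forall>f\<in>E. cinner e f = of_bool (e = f))"

lemma orthonormal_nonzero: "orthonormal E \<Longrightarrow> e \<in> E \<Longrightarrow> e \<noteq> 0"
  by (metis cinner.zero_left of_bool_eq(2) orthonormal_def zero_neq_one)

text \<open>Orthonormality for \<open>cinner\<close> implies orthogonality for the real inner
  product, hence independence over the reals. The real dimension is a crude bound, but enough for
  choosing a system of maximal size.\<close>

lemma orthonormal_finite_card:
  fixes E :: "'a::hermitian_space set"
  assumes "orthonormal E"
  shows "finite E \<and> card E \<le> DIM('a)"
proof (rule independent_bound, rule pairwise_orthogonal_independent)
  show "pairwise orthogonal E"
    using assms by (auto simp: pairwise_def orthogonal_def inner_eq_Re_cinner orthonormal_def)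
  show "0 \<notin> E"
    using assms orthonormal_nonzero by blast
qed

text \<open>Variational argument: \<open>z\<close> makes the orthogonal complement \<open>K\<close>
  of \<open>E\<close> nonzero, and a maximizer \<open>v\<close> of \<open>T v \<bullet> v\<close> on
  its unit sphere satisfies \<open>T v + inv T v = (2 * c) *\<^sub>R v\<close>. Thus (T - l)(T - cnj
  l) v = 0 with l + cnj l = 2c, and either \<open>v\<close> or its image under T - cnj l is an
  eigenvector.\<close>

lemma unitary_eigenvector_in_complement:
  fixes T :: "'a::hermitian_space \<Rightarrow> 'a"
  assumes T: "unitary_operator T"
    and E: "\<And>e. e \<in> E \<Longrightarrow> e \<noteq> 0 \<and> (\<exists>l. T e = l *\<^sub>C e)"
    and z: "z \<noteq> 0" "\<And>e. e \<in> E \<Longrightarrow> cinner z e = 0"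
  shows "\<exists>v l. norm v = 1 \<and> (\<forall>e\<in>E. cinner v e = 0) \<and> T v = l *\<^sub>C v"
proof -
  define K where "K = {v. \<forall>e\<in>E. cinner v e = 0}"
  have K_add: "v + w \<in> K" and K_scaleC: "c *\<^sub>C v \<in> K" if "v \<in> K" "w \<in> K" for v w c
    using that by (simp_all add: K_def cinner_add_left cinner_scaleC_left)
  have K_scaleR: "r *\<^sub>R v \<in> K" if "v \<in> K" for v r
    using that by (simp add: K_def cinner_scaleR_left)
  have K_diff: "v - w \<in> K" if "v \<in> K" "w \<in> K" for v w
    using that by (simp add: K_def cinner.diff_left)
  interpret T: bounded_linear T
    by (rule clinear_imp_bounded_linear[OF unitary_clinear[OF T]])
  have K_inv: "inv T v \<in> K" if "v \<in> K" for v
    using that E by (fastforce simp: K_def cinner_unitary_inv[OF T] cinner_scaleC_right)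
  have K_T: "T v \<in> K" if "v \<in> K" for v
    unfolding K_def
  proof clarify
    fix e assume "e \<in> E"
    then obtain l where l: "T e = l *\<^sub>C e" "e \<noteq> 0" using E by blast
    have "cinner (T v) e = cinner v (inv T e)"
      using cinner_unitary_inv[OF T, of e v] by (metis cinner_commute)
    also have "\<dots> = 0"
      using that \<open>e \<in> E\<close> by (simp add: unitary_inv_eigen[OF T l] cinner_scaleC_right K_def)
    finally show "cinner (T v) e = 0" .
  qed
  have "closed K"
  proof -
    have "K = (\<Inter>e\<in>E. {v. cinner v e = 0})" by (auto simp: K_def)
    then show ?thesis
      by (auto intro!: closed_INT closed_Collect_eq continuous_intros cinner.continuous_on)
  qed
  then have "compact (sphere 0 1 \<inter> K)"
    by (simp add: compact_Int_closed)
  moreover have "(1 / norm z) *\<^sub>R z \<in> sphere 0 1 \<inter> K"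
    using z K_scaleR[of z] by (simp add: K_def)
  moreover have "continuous_on (sphere 0 1 \<inter> K) (\<lambda>v. T v \<bullet> v)"
    by (intro continuous_intros T.continuous_on)
  ultimately obtain v where v: "norm v = 1" "v \<in> K"
    and vmax: "\<And>w. norm w = 1 \<Longrightarrow> w \<in> K \<Longrightarrow> T w \<bullet> w \<le> T v \<bullet> v"
    using continuous_attains_sup[of "sphere 0 1 \<inter> K" "\<lambda>v. T v \<bullet> v"]
    by (metis IntE IntI empty_iff mem_sphere_0)
  define c where "c = T v \<bullet> v"
  have cv: "v \<bullet> T v = c" by (simp add: c_def inner_commute)
  have le: "T w \<bullet> w \<le> c * (w \<bullet> w)" if "w \<in> K" for w
  proof (cases "w = 0")
    case False
    have "T ((1 / norm w) *\<^sub>R w) \<bullet> ((1 / norm w) *\<^sub>R w) \<le> c"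
      unfolding c_def using that False by (intro vmax K_scaleR) auto
    then have "(T w \<bullet> w) / (norm w)\<^sup>2 \<le> c"
      by (simp add: T.scaleR power2_eq_square)
    then show ?thesis
      using False by (simp add: pos_divide_le_eq power2_norm_eq_inner)
  qed simp
  \<comment> \<open>First variation at the maximum in a direction inside \<open>K\<close>;
    \<open>inv T\<close> enters as the adjoint of \<open>T\<close>.\<close>
  have crit: "T v \<bullet> w + inv T v \<bullet> w = 2 * c * (v \<bullet> w)" if w: "w \<in> K" for w
  proof -
    have inv: "inv T v \<bullet> w = T w \<bullet> v"
      by (simp add: inner_eq_Re_cinner cinner_unitary_inv[OF T]) (metis cinner_commute cnj.simps(1))
    define b where "b = T v \<bullet> w + T w \<bullet> v - 2 * c * (v \<bullet> w)"
    define k where "k = c * (w \<bullet> w) - T w \<bullet> w"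
    have *: "t * b \<le> t\<^sup>2 * k" for t
    proof -
      have "T (v + t *\<^sub>R w) \<bullet> (v + t *\<^sub>R w) \<le> c * ((v + t *\<^sub>R w) \<bullet> (v + t *\<^sub>R w))"
        by (intro le K_add K_scaleR v w)
      then show ?thesis
        using v(1) cv
        by (simp add: T.add T.scaleR inner_add_left inner_add_right b_def k_def
            power2_eq_square algebra_simps inner_commute norm_eq_1)
    qed
    have k: "0 \<le> k" using le[OF w] by (simp add: k_def)
    have "b = 0"
    proof (rule ccontr)
      assume "b \<noteq> 0"
      \<comment> \<open>With this choice the linear term \<open>t * b\<close> exceeds the quadratic
        one; the added 1 avoids division by zero when \<open>k = 0\<close>.\<close>
      define t where "t = b / (k + 1)"
      have "t * b \<le> t * (t * k)" using *[of t] by (simp add: power2_eq_square mult.assoc)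
      moreover have "t * b = t * t * (k + 1)" using k by (simp add: t_def)
      ultimately have "t * t \<le> 0" by (simp add: algebra_simps)
      then have "t = 0" by (metis mult_le_0_iff order_antisym zero_le_square mult_eq_0_iff)
      then show False using \<open>b \<noteq> 0\<close> k by (simp add: t_def)
    qed
    then show ?thesis by (simp add: b_def inv)
  qed
  define d where "d = T v + inv T v - (2 * c) *\<^sub>R v"
  have "d \<in> K"
    unfolding d_def by (intro K_diff K_add K_T K_inv K_scaleR v)
  \<comment> \<open>\<open>d\<close> is itself an admissible direction, so the critical equation,
    known only when tested against \<open>K\<close>, becomes an equation of vectors.\<close>
  from crit[OF this] have "d \<bullet> d = 0"
    by (simp add: d_def inner_diff_left inner_add_left)
  then have quad: "T v + inv T v = (2 * c) *\<^sub>R v" by (simp add: d_def)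
  have c: "\<bar>c\<bar> \<le> 1"
    using Cauchy_Schwarz_ineq2[of "T v" v] v(1) by (simp add: c_def unitary_norm[OF T])
  \<comment> \<open>A root of l^2 - 2cl + 1; since |c| is at most 1, the two roots are conjugate and
    lie on the unit circle.\<close>
  define l where "l = Complex c (sqrt (1 - c\<^sup>2))"
  have l: "l + cnj l = complex_of_real (2 * c)" "l * cnj l = 1"
    using c by (simp_all add: l_def complex_eq_iff power2_eq_square[symmetric] abs_square_le_1)
  note lin = clinear_scaleC[OF unitary_clinear[OF T]]
  define u where "u = T v - cnj l *\<^sub>C v"
  show ?thesis
  proof (cases "u = 0")
    case True
    then show ?thesis using v by (auto simp: u_def K_def)
  next
    case False
    have "T (T v) + v = T ((2 * c) *\<^sub>R v)"
      by (simp add: quad[symmetric] T.add unitary_inv_right[OF T])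
    also have "\<dots> = (l + cnj l) *\<^sub>C T v"
      by (simp only: l(1) scaleC_of_real T.scaleR)
    finally have "T (T v) - cnj l *\<^sub>C T v = l *\<^sub>C T v - (l * cnj l) *\<^sub>C v"
      by (simp add: l(2) scaleC_add_left algebra_simps)
    then have Tu: "T u = l *\<^sub>C u"
      by (simp add: u_def T.diff lin complex_vector.scale_right_diff_distrib scaleC_scaleC)
    have uK: "u \<in> K" unfolding u_def by (intro K_diff K_T K_scaleC[OF v(2) v(2)] v)
    define n where "n = (1 / norm u) *\<^sub>R u"
    have "T n = l *\<^sub>C n"
      by (simp add: n_def T.scaleR Tu scaleC.scaleR_right)
    moreover have "norm n = 1" "n \<in> K"
      using False uK by (simp_all add: n_def K_scaleR)
    ultimately show ?thesis by (auto simp: K_def)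
  qed
qed

text \<open>The eigenvalue at a unit eigenvector \<open>e\<close> is written \<open>cinner (T e) e\<close>.\<close>

definition eigenbasis :: "('a::hermitian_space \<Rightarrow> 'a) \<Rightarrow> 'a set \<Rightarrow> bool"
  where "eigenbasis T E \<longleftrightarrow> finite E \<and> orthonormal E \<and> (\<forall>v. v = (\<Sum>e\<in>E. cinner v e *\<^sub>C e)) \<and>
    (\<forall>e\<in>E. T e = cinner (T e) e *\<^sub>C e)"

text \<open>Take an orthonormal system of eigenvectors of largest size. A nonzero vector orthogonal
  to it would allow an extension, so the residual of every expansion, being orthogonal to the
  system, vanishes.\<close>

lemma eigenbasis_exists:
  fixes T :: "'a::hermitian_space \<Rightarrow> 'a"
  assumes T: "unitary_operator T"
  shows "\<exists>E. eigenbasis T E"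
proof -
  define P where "P E \<longleftrightarrow> orthonormal E \<and> (\<forall>e\<in>E. \<exists>l. T e = l *\<^sub>C e)" for E
  have "P {}" by (simp add: P_def orthonormal_def)
  moreover have "card E \<le> DIM('a)" if "P E" for E
    using that orthonormal_finite_card by (auto simp: P_def)
  ultimately obtain E where E: "P E" and Emax: "\<And>F. P F \<Longrightarrow> card F \<le> card E"
    using ex_has_greatest_nat[of P "{}" card "Suc DIM('a)"] by (auto simp: less_Suc_eq_le)
  from E have on: "orthonormal E" and eig: "\<And>e. e \<in> E \<Longrightarrow> \<exists>l. T e = l *\<^sub>C e"
    by (auto simp: P_def)
  have fin: "finite E" using on orthonormal_finite_card by blast
  have ne: "e \<noteq> 0" if "e \<in> E" for e
    using orthonormal_nonzero[OF on that] .
  have complete: "z = 0" if z: "\<And>e. e \<in> E \<Longrightarrow> cinner z e = 0" for z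
  proof (rule ccontr)
    assume "z \<noteq> 0"
    then obtain v l where v: "norm v = 1" "\<And>e. e \<in> E \<Longrightarrow> cinner v e = 0" "T v = l *\<^sub>C v"
      using unitary_eigenvector_in_complement[OF T, of E z] ne eig z by blast
    have "v \<notin> E" using v(1,2) cinner_self[of v] by force
    moreover have "P (insert v E)"
      using on eig v cinner_self[of v] \<open>v \<notin> E\<close>
      by (auto simp: P_def orthonormal_def cinner_eq_0_commute[of _ v])
    ultimately show False using Emax[of "insert v E"] fin by simp
  qed
  have "v = (\<Sum>e\<in>E. cinner v e *\<^sub>C e)" for v
  proof -
    have "cinner (v - (\<Sum>e\<in>E. cinner v e *\<^sub>C e)) f = 0" if "f \<in> E" for f
    proof -
      have "cinner v e * cinner e f = (if e = f then cinner v e else 0)" if "e \<in> E" for e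
        using on that \<open>f \<in> E\<close> by (simp add: orthonormal_def)
      then show ?thesis using that fin
        by (simp add: cinner.diff_left cinner.sum_left cinner_scaleC_left cong: sum.cong)
    qed
    from complete[OF this] show ?thesis by (rule iffD1[OF right_minus_eq])
  qed
  moreover have "T e = cinner (T e) e *\<^sub>C e" if "e \<in> E" for e
    using eig[OF that] on that by (auto simp: orthonormal_def cinner_scaleC_left)
  ultimately show ?thesis
    using fin on unfolding eigenbasis_def by blast
qed

lemma eigenbasisD:
  assumes "eigenbasis T E"
  shows "finite E" "orthonormal E" "v = (\<Sum>e\<in>E. cinner v e *\<^sub>C e)"
    "e \<in> E \<Longrightarrow> T e = cinner (T e) e *\<^sub>C e"
  using assms unfolding eigenbasis_def by blast+

lemma orthonormalD: "orthonormal E \<Longrightarrow> e \<in> E \<Longrightarrow> f \<in> E \<Longrightarrow> cinner e f = of_bool (e = f)"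
  by (simp add: orthonormal_def)

lemma orthonormal_cindependent:
  assumes "finite E" "orthonormal E" shows "\<not> cdependent E"
proof (rule complex_vector.independent_if_scalars_zero[OF assms(1)])
  fix f x assume f: "(\<Sum>x\<in>E. f x *\<^sub>C x) = 0" and x: "x \<in> E"
  have "f e * cinner e x = (if e = x then f e else 0)" if "e \<in> E" for e
    using assms(2) that x by (simp add: orthonormal_def)
  then have "f x = cinner (\<Sum>x\<in>E. f x *\<^sub>C x) x"
    using x assms(1) by (simp add: cinner.sum_left cinner_scaleC_left cong: sum.cong)
  then show "f x = 0" by (simp add: f cinner.zero_left)
qed

section \<open>Dimension, fixed space and trace read off from an eigenbasis\<close>

lemma card_eigenbasis:
  fixes T :: "'a::hermitian_space \<Rightarrow> 'a"
  assumes "eigenbasis T E" shows "card E = cdim (UNIV :: 'a set)"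
proof -
  have "v \<in> cspan E" for v
    by (subst eigenbasisD(3)[OF assms, of v])
       (intro complex_vector.span_sum complex_vector.span_scale complex_vector.span_base)
  then show ?thesis
    using complex_vector.dim_unique[of E UNIV "card E"]
      orthonormal_cindependent[OF eigenbasisD(1,2)[OF assms]] by (simp add: subsetI)
qed

text \<open>Applying \<open>T\<close> multiplies the coefficient at \<open>e\<close> by the
  eigenvalue there; for a fixed vector with nonzero coefficient this factor must be 1.\<close>

lemma eigenbasis_fixed:
  assumes E: "eigenbasis T E" and T: "clinear T" and v: "T v = v" and e: "e \<in> E"
    and ne: "cinner v e \<noteq> 0"
  shows "cinner (T e) e = 1"
proof -
  have *: "cinner (T f) e = (if f = e then cinner (T f) f else 0)" if "f \<in> E" for f
    by (subst eigenbasisD(4)[OF E that])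
       (use orthonormalD[OF eigenbasisD(2)[OF E] that e] in \<open>simp add: cinner_scaleC_left\<close>)
  have "T v = (\<Sum>f\<in>E. cinner v f *\<^sub>C T f)"
    using arg_cong[OF eigenbasisD(3)[OF E, of v], of T]
    by (simp only: clinear_sum[OF T] clinear_scaleC[OF T])
  then have "cinner (T v) e = (\<Sum>f\<in>E. cinner v f * cinner (T f) e)"
    by (simp only: cinner.sum_left cinner_scaleC_left)
  also have "\<dots> = (\<Sum>f\<in>E. if f = e then cinner v f * cinner (T f) f else 0)"
    by (rule sum.cong) (simp_all add: *)
  also have "\<dots> = cinner v e * cinner (T e) e"
    using eigenbasisD(1)[OF E] e by simp
  finally show ?thesis using ne by (simp add: v)
qed

lemma cdim_fixed_eq_card:
  assumes E: "eigenbasis T E" and T: "clinear T"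
  shows "cdim {v. T v = v} = card {e \<in> E. cinner (T e) e = 1}"
proof (rule complex_vector.dim_unique)
  let ?F = "{e \<in> E. cinner (T e) e = 1}"
  show "?F \<subseteq> {v. T v = v}"
    using eigenbasisD(4)[OF E] by fastforce
  show "{v. T v = v} \<subseteq> cspan ?F"
  proof clarify
    fix v assume v: "T v = v"
    have "v = (\<Sum>e\<in>?F. cinner v e *\<^sub>C e)"
      by (subst eigenbasisD(3)[OF E, of v], rule sum.mono_neutral_right)
         (use eigenbasisD(1)[OF E] eigenbasis_fixed[OF E T v] in auto)
    also have "\<dots> \<in> cspan ?F"
      by (intro complex_vector.span_sum complex_vector.span_scale complex_vector.span_base)
    finally show "v \<in> cspan ?F" .
  qed
  show "\<not> cdependent ?F"
    using eigenbasisD(1,2)[OF E] by (intro orthonormal_cindependent) (auto simp: orthonormal_def)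
qed simp

text \<open>Expanding the coordinates of \<open>D b\<close> along \<open>E\<close>, exchanging the
  sums and recombining over the algebraic basis \<open>B\<close> moves the trace to an orthonormal
  basis. That basis diagonalizes \<open>T\<close>, not necessarily \<open>D\<close>.\<close>

lemma op_trace_eigenbasis:
  fixes D :: "'a::hermitian_space \<Rightarrow> 'a"
  assumes E: "eigenbasis T E" and D: "clinear D"
  shows "op_trace D = (\<Sum>e\<in>E. cinner (D e) e)"
proof -
  define B where "B = cextend_basis ({} :: 'a set)"
  have indep: "\<not> cdependent B" and span: "v \<in> cspan B" for v
    unfolding B_def
    using complex_vector.independent_extend_basis[OF complex_vector.independent_empty]
      complex_vector.span_extend_basis[OF complex_vector.independent_empty] by auto
  have finB: "finite B"
  proof (rule complex_vector.independent_span_bound[THEN conjunct1, OF eigenbasisD(1)[OF E] indep])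
    show "B \<subseteq> cspan E"
      by (rule subsetI, subst eigenbasisD(3)[OF E])
         (intro complex_vector.span_sum complex_vector.span_scale complex_vector.span_base)
  qed
  have rep: "crepresentation B v b = (\<Sum>e\<in>E. cinner v e * crepresentation B e b)" for v b
    by (subst eigenbasisD(3)[OF E, of v])
       (simp add: complex_vector.representation_sum[OF indep span]
         complex_vector.representation_scale[OF indep span])
  have exp: "(\<Sum>b\<in>B. crepresentation B v b *\<^sub>C b) = v" for v
    by (rule complex_vector.sum_representation_eq[OF indep span finB]) simp
  have "op_trace D = (\<Sum>b\<in>B. \<Sum>e\<in>E. cinner (D b) e * crepresentation B e b)"
    unfolding op_trace_def B_def[symmetric] by (subst rep) (rule refl)
  also have "\<dots> = (\<Sum>e\<in>E. cinner (D (\<Sum>b\<in>B. crepresentation B e b *\<^sub>C b)) e)"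
    by (subst sum.swap) (simp add: clinear_sum[OF D] clinear_scaleC[OF D] cinner.sum_left
        cinner_scaleC_left mult.commute)
  finally show ?thesis by (simp add: exp)
qed

subsection \<open>Calculus\<close>

text \<open>The terms of the series at \<open>x + s\<close> are bounded, so closer to
  \<open>x\<close> the remainder after the linear term is dominated by a geometric series and is of
  second order.\<close>

lemma real_analytic_imp_has_vector_derivative:
  fixes f :: "real \<Rightarrow> 'b::banach"
  assumes "real_analytic f"
  shows "\<exists>f'. (f has_vector_derivative f') (at x)"
proof -
  obtain r a where r: "r > 0"
    and a: "\<And>y. \<bar>y - x\<bar> < r \<Longrightarrow> (\<lambda>n. (y - x) ^ n *\<^sub>R a n) sums f y"
    using assms unfolding real_analytic_def by meson
  \<comment> \<open>Keeps \<open>x + s\<close> inside the interval of convergence; the later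
    restriction to distance \<open>s / 2\<close> makes the ratio at most 1/2.\<close>
  define s where "s = r / 2"
  have s: "0 < s" "s < r" using r by (auto simp: s_def)
  have "(\<lambda>n. s ^ n *\<^sub>R a n) \<longlonglongrightarrow> 0"
    using a[of "x + s"] s by (intro summable_LIMSEQ_zero) (auto simp: sums_iff)
  then have "Bseq (\<lambda>n. s ^ n *\<^sub>R a n)"
    by (intro convergent_imp_Bseq convergentI)
  then obtain K where "K > 0" and K: "\<And>n. norm (s ^ n *\<^sub>R a n) \<le> K"
    by (rule BseqE) blast
  have fx: "f x = a 0"
  proof -
    have "(\<lambda>n. (x - x) ^ n *\<^sub>R a n) = (\<lambda>n. if n = 0 then a n else 0)"
      by (auto simp: power_0_left)
    then show ?thesis
      using a[of x] r sums_single[of 0 a] sums_unique2 by fastforce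
  qed
  have bound: "norm (f y - f x - (y - x) *\<^sub>R a 1) \<le> 2 * K / s\<^sup>2 * \<bar>y - x\<bar> * \<bar>y - x\<bar>"
    if y: "\<bar>y - x\<bar> < s / 2" for y
  proof -
    define h where "h = y - x"
    have h: "\<bar>h\<bar> < s / 2" using y by (simp add: h_def)
    have "(\<lambda>n. h ^ n *\<^sub>R a n) sums f y" using a[of y] y s by (simp add: h_def)
    from sums_split_initial_segment[OF this, of 2]
    have "(\<lambda>n. h ^ (n + 2) *\<^sub>R a (n + 2)) sums (f y - f x - h *\<^sub>R a 1)"
      by (simp add: fx numeral_2_eq_2 algebra_simps)
    moreover have "(\<lambda>n. h\<^sup>2 * K / s\<^sup>2 * (1/2) ^ n) sums (h\<^sup>2 * K / s\<^sup>2 * 2)"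
      using geometric_sums[of "1/2::real"] by (intro sums_mult) simp
    moreover have "norm (h ^ (n + 2) *\<^sub>R a (n + 2)) \<le> h\<^sup>2 * K / s\<^sup>2 * (1/2) ^ n" for n
    proof -
      have "norm (h ^ (n + 2) *\<^sub>R a (n + 2)) = (\<bar>h\<bar> / s) ^ (n + 2) * norm (s ^ (n + 2) *\<^sub>R a (n + 2))"
        using s by (simp add: power_divide power_abs abs_mult)
      also have "\<dots> \<le> (\<bar>h\<bar> / s) ^ (n + 2) * K"
        using s by (intro mult_left_mono K) auto
      also have "(\<bar>h\<bar> / s) ^ (n + 2) = h\<^sup>2 / s\<^sup>2 * (\<bar>h\<bar> / s) ^ n"
        by (simp only: add.commute[of n 2] power_add power_divide power2_abs)
      also have "\<dots> * K \<le> h\<^sup>2 / s\<^sup>2 * (1/2) ^ n * K"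
        using s h \<open>K > 0\<close> by (intro mult_right_mono mult_left_mono power_mono) (auto simp: field_simps)
      finally show ?thesis by (simp add: mult_ac)
    qed
    ultimately have "norm (f y - f x - h *\<^sub>R a 1) \<le> h\<^sup>2 * K / s\<^sup>2 * 2"
      by (rule norm_sums_le)
    also have "h\<^sup>2 * K / s\<^sup>2 * 2 = 2 * K / s\<^sup>2 * \<bar>h\<bar> * \<bar>h\<bar>"
      by (simp add: power2_eq_square)
    finally show ?thesis by (simp only: h_def)
  qed
  have "(f has_vector_derivative a 1) (at x)"
    unfolding has_vector_derivative_def
  proof (rule has_derivativeI_sandwich[where e = "s / 2" and H = "\<lambda>y. 2 * K / s\<^sup>2 * \<bar>y - x\<bar>"])
    show "((\<lambda>y. 2 * K / s\<^sup>2 * \<bar>y - x\<bar>) \<longlongrightarrow> 0) (at x)"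
      using s by (auto intro!: tendsto_eq_intros)
    fix y assume y: "y \<noteq> x" "dist y x < s / 2"
    show "norm (f y - f x - (y - x) *\<^sub>R a 1) / norm (y - x) \<le> 2 * K / s\<^sup>2 * \<bar>y - x\<bar>"
      using bound[of y] y by (simp add: dist_real_def pos_divide_le_eq)
  qed (use s in \<open>auto intro: bounded_linear_scaleR_left\<close>)
  then show ?thesis ..
qed

text \<open>Squeezing of difference quotients; this turns the angle sum estimate, whose error
  vanishes to second order, into a derivative.\<close>

lemma has_real_derivative_0_of_bound:
  fixes r h :: "real \<Rightarrow> real"
  assumes h: "(h has_real_derivative 0) (at x within T)" and "h x = 0"
    and r: "\<And>y. y \<in> T \<Longrightarrow> \<bar>r y - r x\<bar> \<le> C * h y"
  shows "(r has_real_derivative 0) (at x within T)"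
  unfolding has_field_derivative_iff
proof (rule Lim_null_comparison)
  have "((\<lambda>y. (h y - h x) / (y - x)) \<longlongrightarrow> 0) (at x within T)"
    using h by (simp add: has_field_derivative_iff)
  then have "((\<lambda>y. \<bar>C\<bar> * \<bar>(h y - h x) / (y - x)\<bar>) \<longlongrightarrow> 0) (at x within T)"
    by (intro tendsto_mult_right_zero tendsto_rabs_zero)
  then show "((\<lambda>y. \<bar>C\<bar> * \<bar>(h y - h x) / (y - x)\<bar>) \<longlongrightarrow> 0) (at x within T)" .
  show "\<forall>\<^sub>F y in at x within T. norm ((r y - r x) / (y - x)) \<le> \<bar>C\<bar> * \<bar>(h y - h x) / (y - x)\<bar>"
    unfolding eventually_at_filter
  proof (intro always_eventually allI impI)
    fix y assume "y \<in> T"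
    then have "\<bar>r y - r x\<bar> \<le> \<bar>C * h y\<bar>" using r[of y] by linarith
    then show "norm ((r y - r x) / (y - x)) \<le> \<bar>C\<bar> * \<bar>(h y - h x) / (y - x)\<bar>"
      using \<open>h x = 0\<close> by (simp add: abs_mult divide_right_mono)
  qed
qed

text \<open>Near 0 the left side is of third order and \<open>1 - cos t\<close> of second. The next
  zeros of \<open>1 - cos t\<close> are -2 pi and 2 pi, where the left side does not vanish; the
  margin \<open>\<eta>\<close> excludes them.\<close>

lemma diff_sin_le:
  fixes \<eta> :: real
  assumes "\<eta> > 0"
  shows "\<exists>C. \<forall>t. \<bar>t\<bar> \<le> 2 * pi - \<eta> \<longrightarrow> \<bar>t - sin t\<bar> \<le> C * (1 - cos t)"
proof -
  \<comment> \<open>The cap at \<open>pi / 2\<close> lets \<open>cos t \<le> cos \<epsilon>\<close>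
    hold on the whole range from \<open>pi / 2\<close> to \<open>2 * pi - \<eta>\<close>.\<close>
  define \<epsilon> where "\<epsilon> = min \<eta> (pi / 2)"
  have \<epsilon>: "0 < \<epsilon>" "\<epsilon> \<le> pi / 2" using assms by (auto simp: \<epsilon>_def)
  define c where "c = 1 - cos \<epsilon>"
  have c: "0 < c" using cos_monotone_0_pi[of 0 \<epsilon>] \<epsilon> by (simp add: c_def)
  \<comment> \<open>The summand 1 suffices up to \<open>pi / 2\<close>; beyond,
    \<open>1 - cos t\<close> is at least \<open>c\<close>, so \<open>2 * pi / c\<close> absorbs a
    term 2 pi.\<close>
  define C where "C = 1 + 2 * pi / c"
  have C: "C \<ge> 1" using c by (simp add: C_def)
  have pos: "t - sin t \<le> C * (1 - cos t)" if t: "0 \<le> t" "t \<le> 2 * pi - \<eta>" for t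
  proof (cases "t \<le> pi / 2")
    case True
    have "(\<lambda>t. 1 - cos t - t + sin t) 0 \<le> (\<lambda>t. 1 - cos t - t + sin t) t"
    proof (rule DERIV_nonneg_imp_nondecreasing[OF t(1)])
      fix x assume x: "0 \<le> x" "x \<le> t"
      have "1 \<le> sin x + cos x"
      proof (rule power2_le_imp_le)
        have nn: "0 \<le> sin x" "0 \<le> cos x"
          using x True by (auto intro: sin_ge_zero cos_ge_zero)
        then show "0 \<le> sin x + cos x" by simp
        have "(sin x + cos x)\<^sup>2 = 1 + 2 * (sin x * cos x)"
          using sin_cos_squared_add[of x] by (simp add: power2_sum)
        then show "1\<^sup>2 \<le> (sin x + cos x)\<^sup>2" using nn by simp
      qed
      then show "\<exists>y. ((\<lambda>t. 1 - cos t - t + sin t) has_real_derivative y) (at x) \<and> 0 \<le> y"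
        by (intro exI[of _ "sin x - 1 + cos x"]) (auto intro!: derivative_eq_intros)
    qed
    then have "t - sin t \<le> 1 * (1 - cos t)" by simp
    also have "\<dots> \<le> C * (1 - cos t)" using C by (intro mult_right_mono) auto
    finally show ?thesis .
  next
    case False
    have "cos t \<le> cos \<epsilon>"
    proof (cases "t \<le> pi")
      case True
      then show ?thesis using False \<epsilon> by (intro cos_monotone_0_pi_le) auto
    next
      case False
      have "cos t = cos (2 * pi - t)" by (simp add: cos_diff)
      also have "\<dots> \<le> cos \<epsilon>"
        using False t \<epsilon> by (intro cos_monotone_0_pi_le) (auto simp: \<epsilon>_def)
      finally show ?thesis .
    qed
    then have "c \<le> 1 - cos t" by (simp add: c_def)
    have "2 * pi = 2 * pi / c * c" using c by simp
    also have "\<dots> \<le> 2 * pi / c * (1 - cos t)"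
      using \<open>c \<le> 1 - cos t\<close> c by (intro mult_left_mono) auto
    finally have 1: "2 * pi \<le> 2 * pi / c * (1 - cos t)" .
    have "t - sin t \<le> 2 * pi + (1 - cos t)"
    proof (cases "t \<le> pi")
      case True
      then show ?thesis using sin_ge_zero[of t] t cos_le_one[of t] pi_gt_zero by linarith
    next
      case False
      have "- sin t = sin (2 * pi - t)" by (simp add: sin_diff)
      also have "\<dots> \<le> 2 * pi - t" using t assms by (intro sin_x_le_x) simp
      finally show ?thesis using cos_le_one[of t] by linarith
    qed
    with 1 show ?thesis by (simp add: C_def algebra_simps)
  qed
  have "\<bar>t - sin t\<bar> \<le> C * (1 - cos t)" if t: "\<bar>t\<bar> \<le> 2 * pi - \<eta>" for t
  proof -
    have "\<bar>t - sin t\<bar> = \<bar>\<bar>t\<bar> - sin \<bar>t\<bar>\<bar>" by (auto simp: abs_if)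
    also have "\<dots> = \<bar>t\<bar> - sin \<bar>t\<bar>" using sin_x_le_x[of "\<bar>t\<bar>"] by simp
    also have "\<dots> \<le> C * (1 - cos \<bar>t\<bar>)" using t by (intro pos) auto
    finally show ?thesis by simp
  qed
  then show ?thesis by blast
qed

subsection \<open>Comparing the angle sums of two unitary operators\<close>

lemma eigenbasis_cinner:
  assumes F: "eigenbasis V F" and V: "clinear V"
  shows "cinner (V v) w = (\<Sum>f\<in>F. cinner v f * cinner (V f) f * cinner f w)"
proof -
  have "V v = (\<Sum>f\<in>F. cinner v f *\<^sub>C V f)"
    using arg_cong[OF eigenbasisD(3)[OF F, of v], of V]
    by (simp only: clinear_sum[OF V] clinear_scaleC[OF V])
  then have "cinner (V v) w = (\<Sum>f\<in>F. cinner v f * cinner (V f) w)"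
    by (simp only: cinner.sum_left cinner_scaleC_left)
  also have "\<dots> = (\<Sum>f\<in>F. cinner v f * (cinner (V f) f * cinner f w))"
  proof (rule sum.cong[OF refl])
    fix f assume "f \<in> F"
    then show "cinner v f * cinner (V f) w = cinner v f * (cinner (V f) f * cinner f w)"
      using arg_cong[OF eigenbasisD(4)[OF F \<open>f \<in> F\<close>], of "\<lambda>u. cinner u w"]
      by (simp only: cinner_scaleC_left)
  qed
  finally show ?thesis by (simp only: mult.assoc)
qed

lemma cinner_mult_flip: "cinner v w * cinner w v = complex_of_real ((cmod (cinner v w))\<^sup>2)"
  by (subst (2) cinner_commute) (simp only: complex_norm_square)

text \<open>Gives the row sums of the matrix of squared overlaps of two eigenbases and, with the
  roles exchanged, its column sums.\<close>

lemma eigenbasis_parseval: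
  assumes F: "eigenbasis V F" and "cinner v v = 1"
  shows "(\<Sum>f\<in>F. (cmod (cinner v f))\<^sup>2) = 1"
proof -
  have "cinner v v = (\<Sum>f\<in>F. cinner v f * cinner f v)"
    using arg_cong[OF eigenbasisD(3)[OF F, of v], of "\<lambda>u. cinner u v"]
    by (simp only: cinner.sum_left cinner_scaleC_left)
  also have "\<dots> = complex_of_real (\<Sum>f\<in>F. (cmod (cinner v f))\<^sup>2)"
    by (simp only: cinner_mult_flip of_real_sum)
  finally show ?thesis using assms(2) by (metis of_real_eq_1_iff)
qed

text \<open>The matrix \<open>w\<close> of squared moduli is doubly stochastic, so a difference of angle sums is an
  average of differences of angles; no matching of the two spectra is needed.\<close>

lemma angle_sum_estimate:
  fixes T V :: "'a::hermitian_space \<Rightarrow> 'a"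
  assumes E: "eigenbasis T E" and F: "eigenbasis V F" and V: "clinear V"
    and a: "\<And>e. e \<in> E \<Longrightarrow> cis (a e) = cinner (T e) e"
    and b: "\<And>f. f \<in> F \<Longrightarrow> cis (b f) = cinner (V f) f"
    and C: "\<And>e f. e \<in> E \<Longrightarrow> f \<in> F \<Longrightarrow>
      \<bar>(b f - a e) - sin (b f - a e)\<bar> \<le> C * (1 - cos (b f - a e))"
    and G: "G = (\<Sum>e\<in>E. cinner (V (cnj (cinner (T e) e) *\<^sub>C e)) e)"
  shows "\<bar>(\<Sum>f\<in>F. b f) - (\<Sum>e\<in>E. a e) - Im G\<bar> \<le> C * (real (card E) - Re G)"
proof -
  define w where "w e f = (cmod (cinner e f))\<^sup>2" for e f :: 'a
  have w0: "0 \<le> w e f" for e f by (simp add: w_def)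
  have one: "cinner e e = 1" if "e \<in> E \<union> F" for e
    using that orthonormalD[OF eigenbasisD(2)[OF E]] orthonormalD[OF eigenbasisD(2)[OF F]] by auto
  have wF: "(\<Sum>f\<in>F. w e f) = 1" if "e \<in> E" for e
    unfolding w_def using eigenbasis_parseval[OF F one] that by blast
  have wE: "(\<Sum>e\<in>E. w e f) = 1" if "f \<in> F" for f
  proof -
    have "w e f = (cmod (cinner f e))\<^sup>2" for e
      unfolding w_def by (metis cinner_commute complex_mod_cnj)
    then show ?thesis using eigenbasis_parseval[OF E one, of f] that by simp
  qed
  \<comment> \<open>The argument of \<open>V\<close> stands for the inverse of \<open>T\<close> at
    \<open>e\<close>, so \<open>G\<close> is the trace of \<open>V\<close> after that inverse.
    Expanded along \<open>F\<close>, each diagonal entry is a weighted average of the relative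
    phases.\<close>
  have "cinner (V (cnj (cinner (T e) e) *\<^sub>C e)) e = (\<Sum>f\<in>F. complex_of_real (w e f) * cis (b f - a e))"
    if e: "e \<in> E" for e
  proof -
    have "cinner (V (cnj (cinner (T e) e) *\<^sub>C e)) e
        = (\<Sum>f\<in>F. cnj (cinner (T e) e) * cinner e f * cinner (V f) f * cinner f e)"
      by (subst eigenbasis_cinner[OF F V]) (simp only: cinner_scaleC_left)
    also have "\<dots> = (\<Sum>f\<in>F. complex_of_real (w e f) * cis (b f - a e))"
    proof (rule sum.cong[OF refl])
      fix f assume f: "f \<in> F"
      have "cnj (cinner (T e) e) * cinner (V f) f = cis (b f - a e)"
        by (simp add: a[OF e, symmetric] b[OF f, symmetric] cis_cnj cis_mult)
      moreover have "cinner e f * cinner f e = complex_of_real (w e f)"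
        by (simp only: w_def cinner_mult_flip)
      moreover have "cnj (cinner (T e) e) * cinner e f * cinner (V f) f * cinner f e
          = (cinner e f * cinner f e) * (cnj (cinner (T e) e) * cinner (V f) f)"
        by (simp only: mult_ac)
      ultimately show "cnj (cinner (T e) e) * cinner e f * cinner (V f) f * cinner f e
          = complex_of_real (w e f) * cis (b f - a e)"
        by (simp only:)
    qed
    finally show ?thesis .
  qed
  then have "G = (\<Sum>e\<in>E. \<Sum>f\<in>F. complex_of_real (w e f) * cis (b f - a e))"
    by (simp add: G)
  then have ReG: "Re G = (\<Sum>e\<in>E. \<Sum>f\<in>F. w e f * cos (b f - a e))"
    and ImG: "Im G = (\<Sum>e\<in>E. \<Sum>f\<in>F. w e f * sin (b f - a e))"
    by simp_all
  have "(\<Sum>f\<in>F. b f) = (\<Sum>f\<in>F. \<Sum>e\<in>E. w e f * b f)"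
    by (rule sum.cong) (simp_all add: sum_distrib_right[symmetric] wE)
  also have "\<dots> = (\<Sum>e\<in>E. \<Sum>f\<in>F. w e f * b f)" by (rule sum.swap)
  finally have Sb: "(\<Sum>f\<in>F. b f) = (\<Sum>e\<in>E. \<Sum>f\<in>F. w e f * b f)" .
  have Sa: "(\<Sum>e\<in>E. a e) = (\<Sum>e\<in>E. \<Sum>f\<in>F. w e f * a e)"
    by (rule sum.cong) (simp_all add: sum_distrib_right[symmetric] wF)
  have cd: "real (card E) = (\<Sum>e\<in>E. \<Sum>f\<in>F. w e f)"
    by (simp add: wF)
  have "(\<Sum>f\<in>F. b f) - (\<Sum>e\<in>E. a e) - Im G
      = (\<Sum>e\<in>E. \<Sum>f\<in>F. w e f * ((b f - a e) - sin (b f - a e)))"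
    unfolding Sa Sb ImG by (simp add: sum_subtractf[symmetric] right_diff_distrib)
  also have "\<bar>\<dots>\<bar> \<le> (\<Sum>e\<in>E. \<Sum>f\<in>F. \<bar>w e f * ((b f - a e) - sin (b f - a e))\<bar>)"
    by (intro order_trans[OF sum_abs] sum_mono sum_abs)
  also have "\<dots> \<le> (\<Sum>e\<in>E. \<Sum>f\<in>F. w e f * (C * (1 - cos (b f - a e))))"
    by (intro sum_mono) (simp add: abs_mult w0 mult_left_mono C)
  also have "\<dots> = C * (real (card E) - Re G)"
    unfolding cd ReG by (simp add: sum_distrib_left sum_subtractf[symmetric] right_diff_distrib mult_ac)
  finally show ?thesis .
qed

subsection \<open>Monotone unitary families\<close>

lemma cis_Arg2pi_unit: "cmod z = 1 \<Longrightarrow> cis (Arg2pi z) = z"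
  by (simp add: complex_norm_eq_1_exp cis_conv_exp)

lemma Arg2pi_unit_eq_0: "cmod z = 1 \<Longrightarrow> Arg2pi z = 0 \<longleftrightarrow> z = 1"
  by (metis Arg2pi_of_real cis_Arg2pi_unit cis_zero of_real_1 not_one_less_zero)

locale monotone_family =
  fixes U :: "real \<Rightarrow> 'v::hermitian_space \<Rightarrow>\<^sub>L 'v"
  assumes mono: "monotone_unitary_family U"
begin

abbreviation "D x \<equiv> fam_D U x"

definition U' :: "real \<Rightarrow> 'v \<Rightarrow>\<^sub>L 'v" where "U' x = vector_derivative U (at x)"

lemma unitary: "unitary_operator (blinfun_apply (U x))"
  using mono by (simp add: monotone_unitary_family_def unitary_family_def)

lemma clin: "clinear (blinfun_apply (U x))"
  by (rule unitary_clinear[OF unitary])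

lemma D_clinear: "clinear (D x)"
  and D_symmetric: "cinner (D x v) w = cinner v (D x w)"
  and D_positive: "v \<noteq> 0 \<Longrightarrow> 0 < Re (cinner (D x v) v)"
  using mono unfolding monotone_unitary_family_def positive_operator_def by blast+

lemma has_derivative_U: "(U has_vector_derivative U' x) (at x)"
proof -
  have "real_analytic U"
    using mono by (simp add: monotone_unitary_family_def unitary_family_def)
  then show ?thesis
    unfolding U'_def
    using real_analytic_imp_has_vector_derivative vector_derivative_works differentiableI_vector
    by blast
qed

lemma U'_eq: "blinfun_apply (U' x) (inv (blinfun_apply (U x)) v) = \<i> *\<^sub>C D x v"
  by (simp add: fam_D_def U'_def scaleC_scaleC)

text \<open>An arbitrary choice at every point, with no regularity in \<open>x\<close>.\<close>

definition E :: "real \<Rightarrow> 'v set" where "E x = (SOME F. eigenbasis (blinfun_apply (U x)) F)"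

abbreviation ev :: "real \<Rightarrow> 'v \<Rightarrow> complex"
  where "ev x e \<equiv> cinner (blinfun_apply (U x) e) e"

lemma E: "eigenbasis (blinfun_apply (U x)) (E x)"
  unfolding E_def using eigenbasis_exists[OF unitary] by (rule someI_ex)

lemma fin_E: "finite (E x)"
  by (rule eigenbasisD(1)[OF E])

lemma E_nonzero: "e \<in> E x \<Longrightarrow> e \<noteq> 0"
  by (rule orthonormal_nonzero[OF eigenbasisD(2)[OF E]])

lemma E_ev: "e \<in> E x \<Longrightarrow> blinfun_apply (U x) e = ev x e *\<^sub>C e"
  by (rule eigenbasisD(4)[OF E])

lemma ev_unit: "e \<in> E x \<Longrightarrow> cmod (ev x e) = 1"
  by (rule unitary_eigenvalue_norm[OF unitary E_ev E_nonzero])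

lemma card_E: "card (E x) = cdim (UNIV :: 'v set)"
  by (rule card_eigenbasis[OF E])

text \<open>Symmetry makes the diagonal entries real, so real calculus suffices for the
  complex-valued trace.\<close>

lemma op_trace_D: "op_trace (D x) = complex_of_real (Re (op_trace (D x)))"
proof -
  have "Im (cinner (D x e) e) = 0" for e
    using D_symmetric[of x e e] cinner_commute[of "D x e" e]
    by (metis Reals_cnj_iff complex_is_Real_iff)
  then show ?thesis
    by (simp add: op_trace_eigenbasis[OF E[of x] D_clinear] complex_eq_iff)
qed

section \<open>Derivative of angle sums, and eigenvalues near 1\<close>

text \<open>The branch \<open>ang\<close> and the set \<open>T\<close> are left open to serve both
  angle conventions, to the right and to the left of a point. The gap keeps angle differences away
  from -2 pi and 2 pi, where the comparison with the sine fails.\<close>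

lemma angle_sum_has_derivative:
  assumes "\<eta> > 0" and x: "x \<in> T"
    and cis: "\<And>z. cmod z = 1 \<Longrightarrow> cis (ang z) = z"
    and gap: "\<And>y e f. y \<in> T \<Longrightarrow> e \<in> E x \<Longrightarrow> f \<in> E y \<Longrightarrow>
      \<bar>ang (ev y f) - ang (ev x e)\<bar> \<le> 2 * pi - \<eta>"
  shows "((\<lambda>y. \<Sum>e\<in>E y. ang (ev y e)) has_real_derivative Re (op_trace (D x))) (at x within T)"
proof -
  define S where "S y = (\<Sum>e\<in>E y. ang (ev y e))" for y
  \<comment> \<open>The trace of \<open>U y\<close> after the inverse of \<open>U x\<close>; only
    \<open>U y\<close> varies with \<open>y\<close>, so no eigenbasis has to be
    differentiated.\<close>
  define G where "G y = (\<Sum>e\<in>E x. cinner (blinfun_apply (U y) (cnj (ev x e) *\<^sub>C e)) e)" for y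
  define M where "M = real (card (E x))"
  obtain C where C: "\<And>t. \<bar>t\<bar> \<le> 2 * pi - \<eta> \<Longrightarrow> \<bar>t - sin t\<bar> \<le> C * (1 - cos t)"
    using diff_sin_le[OF \<open>\<eta> > 0\<close>] by blast
  have est: "\<bar>S y - S x - Im (G y)\<bar> \<le> C * (M - Re (G y))" if "y \<in> T" for y
    unfolding S_def M_def
    by (rule angle_sum_estimate[OF E E clin]) (auto simp: G_def cis ev_unit intro!: C gap that)
  have inv: "cnj (ev x e) *\<^sub>C e = inv (blinfun_apply (U x)) e" if "e \<in> E x" for e
    using unitary_inv_eigen[OF unitary E_ev[OF that] E_nonzero[OF that]] by simp
  have Gx: "G x = complex_of_real M"
  proof -
    have "cinner (blinfun_apply (U x) (cnj (ev x e) *\<^sub>C e)) e = 1" if "e \<in> E x" for e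
      using orthonormalD[OF eigenbasisD(2)[OF E] that that]
      by (simp add: inv[OF that] unitary_inv_right[OF unitary])
    then show ?thesis by (simp add: G_def M_def)
  qed
  have dG: "(G has_vector_derivative \<i> * op_trace (D x)) (at x within T)"
  proof -
    have "((\<lambda>y. cinner (blinfun_apply (U y) v) e) has_vector_derivative
        cinner (blinfun_apply (U' x) v) e) (at x within T)" for v e
      by (rule bounded_linear.has_vector_derivative[OF
            bounded_linear_compose[OF cinner.bounded_linear_left blinfun.bounded_linear_left]
            has_vector_derivative_at_within[OF has_derivative_U]])
    then have "(G has_vector_derivative
        (\<Sum>e\<in>E x. cinner (blinfun_apply (U' x) (cnj (ev x e) *\<^sub>C e)) e)) (at x within T)"
      unfolding G_def by (intro has_vector_derivative_sum)
    also have "(\<Sum>e\<in>E x. cinner (blinfun_apply (U' x) (cnj (ev x e) *\<^sub>C e)) e) = \<i> * op_trace (D x)"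
      by (simp add: inv U'_eq cinner_scaleC_left op_trace_eigenbasis[OF E[of x] D_clinear] sum_distrib_left)
    finally show ?thesis .
  qed
  \<comment> \<open>As the trace of \<open>D x\<close> is real, the derivative of \<open>G\<close>
    is purely imaginary: \<open>Re (G y)\<close> is stationary at \<open>x\<close>, and
    \<open>Im (G y)\<close> carries the trace.\<close>
  have ImG: "((\<lambda>y. Im (G y)) has_real_derivative Re (op_trace (D x))) (at x within T)"
    and ReG: "((\<lambda>y. Re (G y)) has_real_derivative 0) (at x within T)"
    using bounded_linear.has_vector_derivative[OF bounded_linear_Im dG]
      bounded_linear.has_vector_derivative[OF bounded_linear_Re dG] op_trace_D[of x]
    by (simp_all add: has_real_derivative_iff_has_vector_derivative complex_eq_iff)
  have "((\<lambda>y. S y - Im (G y)) has_real_derivative 0) (at x within T)"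
  proof (rule has_real_derivative_0_of_bound)
    show "((\<lambda>y. M - Re (G y)) has_real_derivative 0) (at x within T)"
      by (rule derivative_eq_intros ReG refl | simp)+
    show "\<bar>(S y - Im (G y)) - (S x - Im (G x))\<bar> \<le> C * (M - Re (G y))" if "y \<in> T" for y
      using est[OF that] by (simp add: Gx algebra_simps)
  qed (simp add: Gx)
  from DERIV_add[OF this ImG] show ?thesis by (simp add: S_def)
qed

text \<open>Eigenvalues near 1 move counterclockwise: just after \<open>x0\<close> (\<open>s = 1\<close>) none of them lies at or
  slightly below 1, just before \<open>x0\<close> (\<open>s = - 1\<close>) none lies at or slightly above 1.\<close>

lemma no_eigenvalue_behind:
  assumes s: "s = 1 \<or> s = - 1"
  shows "\<exists>\<delta>>0. \<forall>t \<tau> v. 0 < t \<longrightarrow> t < \<delta> \<longrightarrow> 0 \<le> \<tau> \<longrightarrow> \<tau> < \<delta> \<longrightarrow>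
    blinfun_apply (U (x0 + s * t)) v = cis (- s * \<tau>) *\<^sub>C v \<longrightarrow> v = 0"
proof (rule ccontr)
  assume neg: "\<not> ?thesis"
  \<comment> \<open>Failure for every radius 1/(n + 1) yields unit eigenvectors whose time offsets
    and phases tend to 0; a limit of them is fixed by \<open>U x0\<close>.\<close>
  have "\<exists>t \<tau> v. 0 < t \<and> t < 1 / real (Suc n) \<and> 0 \<le> \<tau> \<and> \<tau> < 1 / real (Suc n) \<and>
      blinfun_apply (U (x0 + s * t)) v = cis (- s * \<tau>) *\<^sub>C v \<and> norm v = 1" for n
  proof -
    have "0 < 1 / real (Suc n)" by simp
    then obtain t \<tau> v where *: "0 < t" "t < 1 / real (Suc n)" "0 \<le> \<tau>" "\<tau> < 1 / real (Suc n)"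
      "blinfun_apply (U (x0 + s * t)) v = cis (- s * \<tau>) *\<^sub>C v" "v \<noteq> 0"
      using neg by blast
    moreover have "blinfun_apply (U (x0 + s * t)) ((1 / norm v) *\<^sub>R v) = cis (- s * \<tau>) *\<^sub>C ((1 / norm v) *\<^sub>R v)"
      using * by (simp only: blinfun.scaleR_right scaleC.scaleR_right)
    moreover have "norm ((1 / norm v) *\<^sub>R v) = 1" using * by simp
    ultimately show ?thesis by blast
  qed
  then obtain t \<tau> v where t: "\<And>n. 0 < t n" "\<And>n. t n < 1 / real (Suc n)"
    and \<tau>: "\<And>n. 0 \<le> \<tau> n" "\<And>n. \<tau> n < 1 / real (Suc n)"
    and v: "\<And>n. blinfun_apply (U (x0 + s * t n)) (v n) = cis (- s * \<tau> n) *\<^sub>C v n" "\<And>n. norm (v n) = 1"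
    by metis
  have "\<And>n. v n \<in> sphere 0 1" using v(2) by simp
  then obtain w r where w: "w \<in> sphere 0 1" and r: "strict_mono r" and lim: "(v \<circ> r) \<longlonglongrightarrow> w"
    using compact_sphere[of "0::'v" 1] unfolding compact_def by metis
  define x where "x n = x0 + s * t (r n)" for n
  have inv_Suc: "(\<lambda>n. 1 / real (Suc (r n))) \<longlonglongrightarrow> 0"
    using LIMSEQ_subseq_LIMSEQ[OF LIMSEQ_Suc[OF lim_1_over_n] r] by (simp add: o_def)
  have t0: "(\<lambda>n. t (r n)) \<longlonglongrightarrow> 0"
    by (rule tendsto_sandwich[OF _ _ tendsto_const inv_Suc]) (intro always_eventually allI less_imp_le t)+
  have \<tau>0: "(\<lambda>n. \<tau> (r n)) \<longlonglongrightarrow> 0"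
    by (rule tendsto_sandwich[OF _ _ tendsto_const inv_Suc]) (intro always_eventually allI \<tau> less_imp_le[OF \<tau>(2)])+
  have lim: "(\<lambda>n. v (r n)) \<longlonglongrightarrow> w" using lim by (simp add: o_def)
  have xlim: "x \<longlonglongrightarrow> x0" unfolding x_def by (rule tendsto_eq_intros t0 refl | simp)+
  have ne: "x n \<noteq> x0" for n using t(1)[of "r n"] s by (auto simp: x_def)
  have "isCont U x0" using has_derivative_U by (rule has_vector_derivative_continuous)
  then have "(\<lambda>n. U (x n)) \<longlonglongrightarrow> U x0" using xlim by (rule isCont_tendsto_compose)
  then have "(\<lambda>n. blinfun_apply (U (x n)) (v (r n))) \<longlonglongrightarrow> blinfun_apply (U x0) w"
    by (intro blinfun.tendsto lim)
  moreover have "(\<lambda>n. cis (- s * \<tau> (r n)) *\<^sub>C v (r n)) \<longlonglongrightarrow> cis (- s * 0) *\<^sub>C w"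
    by (intro scaleC.tendsto lim tendsto_cis tendsto_mult tendsto_const \<tau>0)
  ultimately have Uw: "blinfun_apply (U x0) w = w"
    using LIMSEQ_unique by (fastforce simp: v(1) x_def)
  define q where "q n = (U (x n) - U x0) /\<^sub>R (x n - x0)" for n
  have "q \<longlonglongrightarrow> U' x0"
  proof -
    have "((\<lambda>y. norm ((U y - U x0 - (y - x0) *\<^sub>R U' x0) /\<^sub>R \<bar>y - x0\<bar>)) \<longlongrightarrow> 0) (at x0)"
      using has_derivative_U[of x0]
      by (intro tendsto_norm_zero) (simp add: has_vector_derivative_def has_derivative_at_within)
    then have "((\<lambda>y. (U y - U x0) /\<^sub>R (y - x0) - U' x0) \<longlongrightarrow> 0) (at x0)"
    proof (rule Lim_null_comparison[rotated])
      have "norm ((U y - U x0) /\<^sub>R (y - x0) - U' x0)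
          = norm ((U y - U x0 - (y - x0) *\<^sub>R U' x0) /\<^sub>R \<bar>y - x0\<bar>)" if "y \<noteq> x0" for y
      proof -
        have "(U y - U x0) /\<^sub>R (y - x0) - U' x0 = (U y - U x0 - (y - x0) *\<^sub>R U' x0) /\<^sub>R (y - x0)"
          using that by (simp add: scaleR_right_diff_distrib)
        then show ?thesis by (simp only: norm_scaleR abs_inverse abs_abs)
      qed
      then show "\<forall>\<^sub>F y in at x0. norm ((U y - U x0) /\<^sub>R (y - x0) - U' x0)
          \<le> norm ((U y - U x0 - (y - x0) *\<^sub>R U' x0) /\<^sub>R \<bar>y - x0\<bar>)"
        by (simp add: eventually_at_filter)
    qed
    then have "((\<lambda>y. (U y - U x0) /\<^sub>R (y - x0)) \<longlongrightarrow> U' x0) (at x0)"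
      by (rule LIM_zero_cancel)
    then show ?thesis
      unfolding q_def by (rule filterlim_compose) (auto simp: filterlim_at xlim ne)
  qed
  then have lim1: "(\<lambda>n. cinner (blinfun_apply (q n) (v (r n))) w) \<longlonglongrightarrow> cinner (blinfun_apply (U' x0) w) w"
    by (intro cinner.tendsto blinfun.tendsto lim tendsto_const)
  define p where "p n = cinner (v (r n)) w" for n
  have "cinner w w = 1" using w by (simp add: cinner_self)
  then have p1: "p \<longlonglongrightarrow> 1" unfolding p_def using cinner.tendsto[OF lim tendsto_const, of w] by simp
  \<comment> \<open>Pairing with \<open>w\<close> removes \<open>U x0\<close>: it fixes
    \<open>w\<close> and preserves the inner product, so only the phase quotient remains as a factor
    of \<open>p n\<close>.\<close>
  have q: "cinner (blinfun_apply (q n) (v (r n))) w = (cis (- s * \<tau> (r n)) - 1) /\<^sub>R (s * t (r n)) * p n" for n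
  proof -
    have "cinner (blinfun_apply (U x0) (v (r n))) w = p n"
      unfolding p_def using unitary_cinner[OF unitary, of x0 "v (r n)" w] by (simp add: Uw)
    moreover have "cinner (blinfun_apply (U (x n)) (v (r n))) w = cis (- s * \<tau> (r n)) * p n"
      by (simp add: x_def v(1) cinner_scaleC_left p_def)
    ultimately show ?thesis
      by (simp add: q_def blinfun.scaleR_left blinfun.diff_left cinner_scaleR_left cinner.diff_left x_def
          algebra_simps)
  qed
  have "(\<lambda>n. cinner (blinfun_apply (q n) (v (r n))) w / p n) \<longlonglongrightarrow> cinner (blinfun_apply (U' x0) w) w / 1"
    by (intro tendsto_divide lim1 p1) simp
  then have "(\<lambda>n. Im (cinner (blinfun_apply (q n) (v (r n))) w / p n)) \<longlonglongrightarrow> Im (cinner (blinfun_apply (U' x0) w) w)"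
    using tendsto_Im by fastforce
  moreover have "\<forall>\<^sub>F n in sequentially. Im (cinner (blinfun_apply (q n) (v (r n))) w / p n) \<le> 0"
  proof -
    have "\<forall>\<^sub>F n in sequentially. p n \<noteq> 0"
      using tendsto_imp_eventually_ne[OF p1] by simp
    moreover have "\<forall>\<^sub>F n in sequentially. \<tau> (r n) < pi"
      by (rule order_tendstoD[OF \<tau>0]) simp
    ultimately show ?thesis
    proof eventually_elim
      case (elim n)
      have "0 \<le> sin (\<tau> (r n))" using \<tau>(1)[of "r n"] elim by (intro sin_ge_zero) auto
      \<comment> \<open>For either sign \<open>s\<close> this imaginary part is
        \<open>- sin (\<tau> (r n)) / t (r n)\<close>.\<close>
      then have "Im ((cis (- s * \<tau> (r n)) - 1) /\<^sub>R (s * t (r n))) \<le> 0"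
        using s t(1)[of "r n"] by auto
      then show ?case using elim by (simp only: q nonzero_mult_div_cancel_right not_False_eq_True)
    qed
  qed
  ultimately have "Im (cinner (blinfun_apply (U' x0) w) w) \<le> 0"
    by (intro tendsto_upperbound) auto
  moreover have "inv (blinfun_apply (U x0)) w = w"
    using unitary_inv_left[OF unitary, of x0 w] by (simp add: Uw)
  \<comment> \<open>Positivity of \<open>D x0\<close> now makes the imaginary part positive,
    contradicting the limit.\<close>
  then have "cinner (blinfun_apply (U' x0) w) w = \<i> * cinner (D x0 w) w"
    using U'_eq[of x0 w] by (simp add: cinner_scaleC_left)
  moreover have "w \<noteq> 0" using w by auto
  ultimately show False using D_positive[of w x0] by simp
qed

text \<open>To the left, \<open>c\<close> is conjugation, so in both directions the forbidden side
  of 1 lies just below the angle 2 pi. At \<open>t = 0\<close> the eigenvalue 1 is allowed; its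
  angle is 0.\<close>

lemma spectral_gap_behind:
  assumes s: "s = 1 \<or> s = - 1" and c: "\<And>z. c z = (if s = 1 then z else cnj z)"
  shows "\<exists>\<delta>>0. \<exists>\<eta>>0. \<forall>t e. 0 \<le> t \<longrightarrow> t < \<delta> \<longrightarrow> e \<in> E (x0 + s * t) \<longrightarrow>
    Arg2pi (c (ev (x0 + s * t) e)) \<le> 2 * pi - \<eta> \<and> (0 < t \<longrightarrow> ev (x0 + s * t) e \<noteq> 1)"
proof -
  obtain \<delta> where "\<delta> > 0" and \<delta>: "\<And>t \<tau> v. 0 < t \<Longrightarrow> t < \<delta> \<Longrightarrow> 0 \<le> \<tau> \<Longrightarrow> \<tau> < \<delta> \<Longrightarrow>
    blinfun_apply (U (x0 + s * t)) v = cis (- s * \<tau>) *\<^sub>C v \<Longrightarrow> v = 0"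
    using no_eigenvalue_behind[OF s] by metis
  have pos: "Arg2pi (c (ev (x0 + s * t) e)) \<le> 2 * pi - \<delta> \<and> ev (x0 + s * t) e \<noteq> 1"
    if t: "0 < t" "t < \<delta>" and e: "e \<in> E (x0 + s * t)" for t e
  proof
    define z where "z = ev (x0 + s * t) e"
    have "cmod (c z) = cmod z" by (simp add: c)
    then have z: "cmod (c z) = 1" by (simp only: z_def ev_unit[OF e])
    have no: "z \<noteq> cis (- s * \<tau>)" if "0 \<le> \<tau>" "\<tau> < \<delta>" for \<tau>
      using \<delta>[OF t that, of e] E_ev[OF e] E_nonzero[OF e] by (auto simp: z_def)
    show "ev (x0 + s * t) e \<noteq> 1"
      using no[of 0] \<open>\<delta> > 0\<close> by (simp add: z_def)
    show "Arg2pi (c (ev (x0 + s * t) e)) \<le> 2 * pi - \<delta>"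
    proof (rule ccontr)
      assume "\<not> ?thesis"
      then have lt: "2 * pi - Arg2pi (c z) < \<delta>" by (simp add: z_def)
      \<comment> \<open>An angle beyond \<open>2 * pi - \<delta>\<close> is a small negative phase
        modulo 2 pi; undoing \<open>c\<close> produces an excluded eigenvalue.\<close>
      have "cis (- (2 * pi - Arg2pi (c z))) = cis (Arg2pi (c z))"
        by (simp add: complex_eq_iff cos_diff sin_diff)
      then have "cis (- (2 * pi - Arg2pi (c z))) = c z"
        by (simp only: cis_Arg2pi_unit[OF z])
      then have "z = c (cis (- (2 * pi - Arg2pi (c z))))"
        by (simp only: c complex_cnj_cnj split: if_split) simp
      also have "\<dots> = cis (- s * (2 * pi - Arg2pi (c z)))"
        using s by (auto simp: c cis_cnj)
      finally have "z = cis (- s * (2 * pi - Arg2pi (c z)))" .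
      then show False using no[OF _ lt] Arg2pi[of "c z"] by force
    qed
  qed
  \<comment> \<open>At the base point, finitely many angles strictly below 2 pi leave a
    margin.\<close>
  define A where "A = Max (insert 0 ((\<lambda>e. Arg2pi (c (ev x0 e))) ` E x0))"
  have A: "A < 2 * pi" "\<And>e. e \<in> E x0 \<Longrightarrow> Arg2pi (c (ev x0 e)) \<le> A"
    using fin_E[of x0] Arg2pi by (auto simp: A_def Max_ge)
  define \<eta> where "\<eta> = min \<delta> (2 * pi - A)"
  have "\<eta> > 0" using A(1) \<open>\<delta> > 0\<close> by (simp add: \<eta>_def)
  moreover have "Arg2pi (c (ev (x0 + s * t) e)) \<le> 2 * pi - \<eta> \<and> (0 < t \<longrightarrow> ev (x0 + s * t) e \<noteq> 1)"
    if "0 \<le> t" "t < \<delta>" "e \<in> E (x0 + s * t)" for t e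
  proof (cases "t = 0")
    case True
    then show ?thesis using A(2)[of e] that by (simp add: \<eta>_def)
  next
    case False
    moreover have "\<eta> \<le> \<delta>" by (simp add: \<eta>_def)
    ultimately show ?thesis using pos[of t e] that by fastforce
  qed
  ultimately show ?thesis using \<open>\<delta> > 0\<close> by blast
qed

section \<open>Angle sums under the two conventions at eigenvalue 1\<close>

definition lo :: "real \<Rightarrow> real" where "lo x = (\<Sum>e\<in>E x. Arg2pi (ev x e))"
text \<open>Conjugation reverses the half-open interval: \<open>2 * pi - Arg2pi (cnj z)\<close> is
  the argument of a nonzero \<open>z\<close> in (0, 2 pi].\<close>

definition hi :: "real \<Rightarrow> real" where "hi x = (\<Sum>e\<in>E x. 2 * pi - Arg2pi (cnj (ev x e)))"

lemma fam_W_eq: "fam_W U x = {v. blinfun_apply (U x) v = v}"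
  by (auto simp: fam_W_def blinfun.diff_left)

lemma fam_Z_iff: "x \<in> fam_Z U \<longleftrightarrow> (\<exists>e\<in>E x. ev x e = 1)"
proof
  assume "x \<in> fam_Z U"
  moreover have "0 \<in> fam_W U x" by (simp add: fam_W_eq)
  ultimately obtain v where v: "v \<noteq> 0" "blinfun_apply (U x) v = v"
    by (auto simp: fam_Z_def fam_W_eq)
  have "\<exists>e\<in>E x. cinner v e \<noteq> 0"
  proof (rule ccontr)
    assume "\<not> ?thesis"
    then have "(\<Sum>e\<in>E x. cinner v e *\<^sub>C e) = 0" by simp
    then show False using v(1) eigenbasisD(3)[OF E, of v x] by metis
  qed
  then show "\<exists>e\<in>E x. ev x e = 1"
    using eigenbasis_fixed[OF E clin v(2)] by blast
next
  assume "\<exists>e\<in>E x. ev x e = 1"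
  then obtain e where e: "e \<in> E x" "ev x e = 1" by blast
  then have "e \<in> fam_W U x" using E_ev[OF e(1)] by (simp add: fam_W_eq)
  then show "x \<in> fam_Z U" using E_nonzero[OF e(1)] by (auto simp: fam_Z_def)
qed

text \<open>The two branches agree except at eigenvalue 1, where they give 0 and 2 pi; the
  eigenvectors for 1 number the dimension of the fixed space.\<close>

lemma hi_eq_lo: "hi x = lo x + 2 * pi * real (cdim (fam_W U x))"
proof -
  have "2 * pi - Arg2pi (cnj (ev x e)) = Arg2pi (ev x e) + (if ev x e = 1 then 2 * pi else 0)"
    if "e \<in> E x" for e
  proof (cases "ev x e \<in> \<real>")
    case True
    then obtain r where r: "ev x e = complex_of_real r" by (auto elim: Reals_cases)
    then have "r = 1 \<or> r = - 1" using ev_unit[OF that] by auto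
    then show ?thesis by (auto simp: r Arg2pi_of_real)
  next
    case False
    then show ?thesis by (auto simp: Arg2pi_cnj)
  qed
  then have "hi x = (\<Sum>e\<in>E x. Arg2pi (ev x e) + (if ev x e = 1 then 2 * pi else 0))"
    unfolding hi_def by (rule sum.cong[OF refl])
  also have "\<dots> = lo x + real (card {e \<in> E x. ev x e = 1}) * (2 * pi)"
    using fin_E[of x] by (simp add: sum.distrib lo_def sum.If_cases Int_def)
  finally show ?thesis
    by (simp add: fam_W_eq cdim_fixed_eq_card[OF E clin])
qed

lemma hi_eq_lo': "x \<notin> fam_Z U \<Longrightarrow> hi x = lo x"
  using fin_E[of x] by (simp add: hi_eq_lo fam_W_eq cdim_fixed_eq_card[OF E clin] fam_Z_iff)

section \<open>Integrating the trace: one-sided formulas and gluing\<close>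

text \<open>Just after \<open>x0\<close> no angle in [0, 2 pi) approaches 2 pi, so \<open>lo\<close>
  is differentiable down to and including \<open>x0\<close>, even when \<open>x0\<close> lies in
  \<open>fam_Z U\<close>.\<close>

lemma has_integral_right:
  "\<exists>\<delta>>0. \<forall>b. x0 < b \<longrightarrow> b < x0 + \<delta> \<longrightarrow> b \<notin> fam_Z U \<and>
    ((\<lambda>x. op_trace (D x)) has_integral complex_of_real (lo b - lo x0)) {x0..b}"
proof -
  obtain \<delta> \<eta> where "\<delta> > 0" "\<eta> > 0" and
    gap: "\<And>t e. 0 \<le> t \<Longrightarrow> t < \<delta> \<Longrightarrow> e \<in> E (x0 + t) \<Longrightarrow>
      Arg2pi (ev (x0 + t) e) \<le> 2 * pi - \<eta> \<and> (0 < t \<longrightarrow> ev (x0 + t) e \<noteq> 1)"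
    using spectral_gap_behind[of 1 "\<lambda>z. z" x0] by auto
  have gap': "Arg2pi (ev y e) \<le> 2 * pi - \<eta>" "0 \<le> Arg2pi (ev y e)"
    if "x0 \<le> y" "y < x0 + \<delta>" "e \<in> E y" for y e
    using gap[of "y - x0" e] that Arg2pi by auto
  show ?thesis
  proof (intro exI[of _ \<delta>] conjI allI impI)
    fix b assume b: "x0 < b" "b < x0 + \<delta>"
    show "b \<notin> fam_Z U"
      using gap[of "b - x0"] b by (auto simp: fam_Z_iff)
    have "((\<lambda>x. op_trace (D x)) has_integral complex_of_real (lo b) - complex_of_real (lo x0)) {x0..b}"
    proof (rule fundamental_theorem_of_calculus)
      fix x assume x: "x \<in> {x0..b}"
      have "(lo has_real_derivative Re (op_trace (D x))) (at x within {x0..b})"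
        unfolding lo_def
      proof (rule angle_sum_has_derivative[OF \<open>\<eta> > 0\<close> x cis_Arg2pi_unit])
        fix y e f assume "y \<in> {x0..b}" "e \<in> E x" "f \<in> E y"
        then show "\<bar>Arg2pi (ev y f) - Arg2pi (ev x e)\<bar> \<le> 2 * pi - \<eta>"
          using gap'[of y f] gap'[of x e] x b by auto
      qed
      then show "((\<lambda>y. complex_of_real (lo y)) has_vector_derivative op_trace (D x)) (at x within {x0..b})"
        by (subst op_trace_D) (simp add: has_real_derivative_iff_has_vector_derivative has_vector_derivative_of_real)
    qed (use b in simp)
    then show "((\<lambda>x. op_trace (D x)) has_integral complex_of_real (lo b - lo x0)) {x0..b}"
      by simp
  qed fact
qed

text \<open>Mirror image: just before \<open>x0\<close> the angles in (0, 2 pi] stay away from 0, so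
  here \<open>hi\<close> is the branch differentiable up to \<open>x0\<close>.\<close>

lemma has_integral_left:
  "\<exists>\<delta>>0. \<forall>a. x0 - \<delta> < a \<longrightarrow> a < x0 \<longrightarrow> a \<notin> fam_Z U \<and>
    ((\<lambda>x. op_trace (D x)) has_integral complex_of_real (hi x0 - hi a)) {a..x0}"
proof -
  obtain \<delta> \<eta> where "\<delta> > 0" "\<eta> > 0" and
    gap: "\<And>t e. 0 \<le> t \<Longrightarrow> t < \<delta> \<Longrightarrow> e \<in> E (x0 - t) \<Longrightarrow>
      Arg2pi (cnj (ev (x0 - t) e)) \<le> 2 * pi - \<eta> \<and> (0 < t \<longrightarrow> ev (x0 - t) e \<noteq> 1)"
    using spectral_gap_behind[of "- 1" cnj x0] by auto
  have gap': "Arg2pi (cnj (ev y e)) \<le> 2 * pi - \<eta>" "0 \<le> Arg2pi (cnj (ev y e))"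
    if "x0 - \<delta> < y" "y \<le> x0" "e \<in> E y" for y e
    using gap[of "x0 - y" e] that Arg2pi by auto
  have cis: "cis (2 * pi - Arg2pi (cnj z)) = z" if "cmod z = 1" for z
  proof -
    have "cis (2 * pi - Arg2pi (cnj z)) = cnj (cis (Arg2pi (cnj z)))"
      by (simp add: complex_eq_iff cos_diff sin_diff)
    then show ?thesis using that by (simp add: cis_Arg2pi_unit)
  qed
  show ?thesis
  proof (intro exI[of _ \<delta>] conjI allI impI)
    fix a assume a: "x0 - \<delta> < a" "a < x0"
    show "a \<notin> fam_Z U"
      using gap[of "x0 - a"] a by (auto simp: fam_Z_iff)
    have "((\<lambda>x. op_trace (D x)) has_integral complex_of_real (hi x0) - complex_of_real (hi a)) {a..x0}"
    proof (rule fundamental_theorem_of_calculus)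
      fix x assume x: "x \<in> {a..x0}"
      have "(hi has_real_derivative Re (op_trace (D x))) (at x within {a..x0})"
        unfolding hi_def
      proof (rule angle_sum_has_derivative[OF \<open>\<eta> > 0\<close> x cis])
        fix y e f assume "y \<in> {a..x0}" "e \<in> E x" "f \<in> E y"
        then show "\<bar>(2 * pi - Arg2pi (cnj (ev y f))) - (2 * pi - Arg2pi (cnj (ev x e)))\<bar> \<le> 2 * pi - \<eta>"
          using gap'[of y f] gap'[of x e] x a by auto
      qed
      then show "((\<lambda>y. complex_of_real (hi y)) has_vector_derivative op_trace (D x)) (at x within {a..x0})"
        by (subst op_trace_D) (simp add: has_real_derivative_iff_has_vector_derivative has_vector_derivative_of_real)
    qed (use a in simp)
    then show "((\<lambda>x. op_trace (D x)) has_integral complex_of_real (hi x0 - hi a)) {a..x0}"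
      by simp
  qed fact
qed

lemma fam_Z_isolated: "\<exists>\<delta>>0. \<forall>y. \<bar>y - x\<bar> < \<delta> \<longrightarrow> y \<in> fam_Z U \<longrightarrow> y = x"
proof -
  obtain d1 where d1: "d1 > 0" "\<And>b. x < b \<Longrightarrow> b < x + d1 \<Longrightarrow> b \<notin> fam_Z U"
    using has_integral_right[of x] by blast
  obtain d2 where d2: "d2 > 0" "\<And>b. x - d2 < b \<Longrightarrow> b < x \<Longrightarrow> b \<notin> fam_Z U"
    using has_integral_left[of x] by blast
  show ?thesis
  proof (intro exI[of _ "min d1 d2"] conjI allI impI)
    fix y assume y: "\<bar>y - x\<bar> < min d1 d2" "y \<in> fam_Z U"
    then show "y = x" using d1(2)[of y] d2(2)[of y] by (cases y x rule: linorder_cases) auto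
  qed (use d1 d2 in simp)
qed

lemma discrete_fam_Z: "discrete (fam_Z U)"
  unfolding discrete_def isolated_in_dist_Ex_iff dist_real_def
  using fam_Z_isolated by (metis abs_minus_commute)

text \<open>Bisection reduces the claim to short intervals and to gluing. Gluing at \<open>b\<close>
  leaves the jump \<open>hi b - lo b\<close>, which is exactly the contribution of \<open>b\<close>
  to the count.\<close>

lemma finite_and_has_integral:
  assumes "A < B"
  shows "finite (fam_Z U \<inter> {A<..<B}) \<and>
    ((\<lambda>x. op_trace (D x)) has_integral complex_of_real (hi B - lo A +
      2 * pi * real (\<Sum>x\<in>fam_Z U \<inter> {A<..<B}. cdim (fam_W U x)))) {A..B}"
proof -
  define N where "N a b = (\<Sum>x\<in>fam_Z U \<inter> {a<..<b}. cdim (fam_W U x))" for a b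
  \<comment> \<open>Void unless \<open>a < b\<close>: for \<open>a = b\<close> the formula would
    fail at points of \<open>fam_Z U\<close>, where \<open>hi\<close> and \<open>lo\<close>
    differ.\<close>
  define P where "P a b \<longleftrightarrow> a < b \<longrightarrow> finite (fam_Z U \<inter> {a<..<b}) \<and>
    ((\<lambda>x. op_trace (D x)) has_integral complex_of_real (hi b - lo a + 2 * pi * real (N a b))) {a..b}"
    for a b
  have trans: "P a c" if "P a b" "P b c" "a \<le> b" "b \<le> c" for a b c
  proof (cases "a < b \<and> b < c")
    case True
    have split: "fam_Z U \<inter> {a<..<c} = (fam_Z U \<inter> {a<..<b}) \<union> (fam_Z U \<inter> {b}) \<union> (fam_Z U \<inter> {b<..<c})"
      using True by auto
    have fin: "finite (fam_Z U \<inter> {a<..<b})" "finite (fam_Z U \<inter> {b<..<c})"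
      and int: "((\<lambda>x. op_trace (D x)) has_integral complex_of_real (hi b - lo a + 2 * pi * real (N a b))) {a..b}"
        "((\<lambda>x. op_trace (D x)) has_integral complex_of_real (hi c - lo b + 2 * pi * real (N b c))) {b..c}"
      using that True by (auto simp: P_def)
    have "N a c = N a b + (\<Sum>x\<in>fam_Z U \<inter> {b}. cdim (fam_W U x)) + N b c"
      unfolding N_def split by (subst sum.union_disjoint, use fin in force, use fin in force, force)+ (rule refl)
    moreover have "hi b = lo b + 2 * pi * real (\<Sum>x\<in>fam_Z U \<inter> {b}. cdim (fam_W U x))"
      using hi_eq_lo[of b] hi_eq_lo'[of b] by (cases "b \<in> fam_Z U") auto
    ultimately have "(hi b - lo a + 2 * pi * real (N a b)) + (hi c - lo b + 2 * pi * real (N b c))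
        = hi c - lo a + 2 * pi * real (N a c)"
      by (simp add: algebra_simps)
    with has_integral_combine[OF that(3,4) int]
    have "((\<lambda>x. op_trace (D x)) has_integral
        complex_of_real (hi c - lo a + 2 * pi * real (N a c))) {a..c}"
      by (simp only: of_real_add[symmetric])
    then show ?thesis
      using fin unfolding P_def split by blast
  next
    case False
    then show ?thesis using that by (cases "a = b") auto
  qed
  have "P A B"
  \<comment> \<open>A short interval around \<open>x\<close> is cut at \<open>x\<close>. Neither
    half has a point of \<open>fam_Z U\<close> in its interior, and at the far ends
    \<open>lo\<close> and \<open>hi\<close> coincide.\<close>
  proof (rule Bolzano[OF less_imp_le[OF assms] trans])
    fix x
    obtain d1 where d1: "d1 > 0" "\<And>b. x < b \<Longrightarrow> b < x + d1 \<Longrightarrow> b \<notin> fam_Z U \<and>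
        ((\<lambda>x. op_trace (D x)) has_integral complex_of_real (lo b - lo x)) {x..b}"
      using has_integral_right[of x] by blast
    obtain d2 where d2: "d2 > 0" "\<And>b. x - d2 < b \<Longrightarrow> b < x \<Longrightarrow> b \<notin> fam_Z U \<and>
        ((\<lambda>x. op_trace (D x)) has_integral complex_of_real (hi x - hi b)) {b..x}"
      using has_integral_left[of x] by blast
    have "P x b" if "b < x + d1" for b
    proof -
      have "fam_Z U \<inter> {x<..<b} = {}" if "x < b" using d1(2) \<open>b < x + d1\<close> by fastforce
      then show ?thesis using d1(2)[of b] that hi_eq_lo'[of b] by (auto simp: P_def N_def)
    qed
    moreover have "P a x" if "x - d2 < a" for a
    proof -
      have "fam_Z U \<inter> {a<..<x} = {}" if "a < x" using d2(2) \<open>x - d2 < a\<close> by fastforce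
      then show ?thesis using d2(2)[of a] that hi_eq_lo'[of a] by (auto simp: P_def N_def)
    qed
    ultimately have "P a b" if "a \<le> x" "x \<le> b" "b - a < min d1 d2" for a b
      using trans[of a x b] that by simp
    then show "\<exists>d>0. \<forall>a b. a \<le> x \<and> x \<le> b \<and> b - a < d \<longrightarrow> P a b"
      using d1(1) d2(1) by (intro exI[of _ "min d1 d2"]) auto
  qed
  then show ?thesis using assms by (simp add: P_def N_def)
qed

section \<open>Bounds for the angle sums and their extreme cases\<close>

text \<open>A Euclidean space has a nonempty real basis, so the zero space is excluded; this makes
  \<open>lo < 2 * pi * M\<close> and \<open>0 < hi\<close> strict.\<close>

lemma E_nonempty: "E x \<noteq> {}"
proof
  assume "E x = {}"
  then have "v = 0" for v :: 'v using eigenbasisD(3)[OF E, of v x] by simp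
  then show False using nonzero_Basis nonempty_Basis by blast
qed

lemma U_eq_id:
  assumes "\<And>e. e \<in> E x \<Longrightarrow> ev x e = 1" shows "U x = id_blinfun"
proof (rule blinfun_eqI)
  fix v
  have "blinfun_apply (U x) v = (\<Sum>e\<in>E x. cinner v e *\<^sub>C blinfun_apply (U x) e)"
    using arg_cong[OF eigenbasisD(3)[OF E, of v], of "blinfun_apply (U x)"]
    by (simp only: clinear_sum[OF clin] clinear_scaleC[OF clin])
  also have "\<dots> = (\<Sum>e\<in>E x. cinner v e *\<^sub>C e)"
    by (rule sum.cong[OF refl]) (metis E_ev assms scaleC_1)
  also have "\<dots> = v" using eigenbasisD(3)[OF E, of v x] ..
  finally show "blinfun_apply (U x) v = blinfun_apply id_blinfun v" by simp
qed

lemma lo_bounds: "0 \<le> lo x" "lo x < 2 * pi * real (cdim (UNIV :: 'v set))"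
proof -
  show "0 \<le> lo x" unfolding lo_def using Arg2pi by (intro sum_nonneg) auto
  have "lo x < (\<Sum>e\<in>E x. 2 * pi)"
    unfolding lo_def using Arg2pi by (intro sum_strict_mono fin_E E_nonempty) auto
  then show "lo x < 2 * pi * real (cdim (UNIV :: 'v set))" by (simp add: card_E mult.commute)
qed

text \<open>A vanishing sum of nonnegative angles forces every eigenvalue to be 1. With
  \<open>hi_eq_max\<close> this isolates the one configuration in which strictness can fail.\<close>

lemma lo_eq_0: "lo x = 0 \<Longrightarrow> U x = id_blinfun"
proof (rule U_eq_id)
  fix e assume "lo x = 0" and e: "e \<in> E x"
  then have "Arg2pi (ev x e) = 0"
    unfolding lo_def using Arg2pi by (subst (asm) sum_nonneg_eq_0_iff[OF fin_E]) auto
  then show "ev x e = 1" using Arg2pi_unit_eq_0[OF ev_unit[OF e]] by simp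
qed

lemma hi_eq: "hi x = 2 * pi * real (cdim (UNIV :: 'v set)) - (\<Sum>e\<in>E x. Arg2pi (cnj (ev x e)))"
  by (simp add: hi_def sum_subtractf card_E mult.commute)

lemma hi_bounds: "0 < hi x" "hi x \<le> 2 * pi * real (cdim (UNIV :: 'v set))"
proof -
  show "0 < hi x" unfolding hi_def using Arg2pi by (intro sum_pos fin_E E_nonempty) auto
  have "0 \<le> (\<Sum>e\<in>E x. Arg2pi (cnj (ev x e)))" using Arg2pi by (intro sum_nonneg) auto
  then show "hi x \<le> 2 * pi * real (cdim (UNIV :: 'v set))" by (simp add: hi_eq)
qed

lemma hi_eq_max: "hi x = 2 * pi * real (cdim (UNIV :: 'v set)) \<Longrightarrow> U x = id_blinfun"
proof (rule U_eq_id)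
  fix e assume "hi x = 2 * pi * real (cdim (UNIV :: 'v set))" and e: "e \<in> E x"
  then have "(\<Sum>e\<in>E x. Arg2pi (cnj (ev x e))) = 0" by (simp add: hi_eq)
  then have "Arg2pi (cnj (ev x e)) = 0"
    using Arg2pi e by (subst (asm) sum_nonneg_eq_0_iff[OF fin_E]) auto
  then show "ev x e = 1" using Arg2pi_unit_eq_0[of "cnj (ev x e)"] ev_unit[OF e] by simp
qed

end

theorem theorem1:
  fixes U :: "real \<Rightarrow> 'v::hermitian_space \<Rightarrow>\<^sub>L 'v"
  assumes "monotone_unitary_family U"
  shows "discrete (fam_Z U) \<and>
    (\<forall>A B. A < B \<longrightarrow>
      finite (fam_Z U \<inter> {A<..<B}) \<and>
      (let \<delta> = cmod (of_nat (\<Sum>x\<in>fam_Z U \<inter> {A<..<B}. cdim (fam_W U x))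
                    - 1 / (2 * pi) * integral {A..B} (\<lambda>x. op_trace (fam_D U x)));
           M = real (cdim (UNIV :: 'v set))
       in \<delta> \<le> M \<and> (\<not> (U A = id_blinfun \<and> U B = id_blinfun) \<longrightarrow> \<delta> < M)))"
proof (intro conjI allI impI)
  interpret monotone_family U by unfold_locales (rule assms)
  show "discrete (fam_Z U)" by (rule discrete_fam_Z)
  fix A B :: real assume "A < B"
  note AB = finite_and_has_integral[OF this]
  show "finite (fam_Z U \<inter> {A<..<B})" using AB by blast
  define N where "N = (\<Sum>x\<in>fam_Z U \<inter> {A<..<B}. cdim (fam_W U x))"
  define M where "M = real (cdim (UNIV :: 'v set))"
  have int: "integral {A..B} (\<lambda>x. op_trace (fam_D U x)) = complex_of_real (hi B - lo A + 2 * pi * real N)"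
    unfolding N_def using AB by (intro integral_unique) blast
  \<comment> \<open>The count cancels, leaving only the angle sums at the two endpoints.\<close>
  have "of_nat N - 1 / (2 * pi) * integral {A..B} (\<lambda>x. op_trace (fam_D U x))
      = complex_of_real ((lo A - hi B) / (2 * pi))"
    unfolding int by (simp add: field_simps)
  then have \<delta>: "cmod (of_nat N - 1 / (2 * pi) * integral {A..B} (\<lambda>x. op_trace (fam_D U x)))
      = \<bar>lo A - hi B\<bar> / (2 * pi)"
    by (simp only: norm_of_real) simp
  have le: "\<bar>lo A - hi B\<bar> \<le> 2 * pi * M"
    using lo_bounds[of A] hi_bounds[of B] unfolding M_def by linarith
  \<comment> \<open>\<open>lo A - hi B\<close> is always below \<open>2 * pi * M\<close>, so the
    bound can be attained only by \<open>hi B - lo A\<close>, which requires \<open>lo A = 0\<close>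
    and \<open>hi B = 2 * pi * M\<close> together.\<close>
  have lt: "\<bar>lo A - hi B\<bar> < 2 * pi * M" if "\<not> (U A = id_blinfun \<and> U B = id_blinfun)"
  proof -
    have "lo A \<noteq> 0 \<or> hi B \<noteq> 2 * pi * M"
      using that lo_eq_0[of A] hi_eq_max[of B] unfolding M_def by blast
    then show ?thesis
      using lo_bounds[of A] hi_bounds[of B] unfolding M_def by linarith
  qed
  show "let \<delta> = cmod (of_nat (\<Sum>x\<in>fam_Z U \<inter> {A<..<B}. cdim (fam_W U x))
                    - 1 / (2 * pi) * integral {A..B} (\<lambda>x. op_trace (fam_D U x)));
           M = real (cdim (UNIV :: 'v set))
       in \<delta> \<le> M \<and> (\<not> (U A = id_blinfun \<and> U B = id_blinfun) \<longrightarrow> \<delta> < M)"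
    unfolding Let_def N_def[symmetric] M_def[symmetric] \<delta>
    using le lt by (simp add: divide_le_eq divide_less_eq mult.commute)
qed

end
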